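(* Let $x>0$ and let $r,s\in\mathbb{C}\setminus\mathbb{Z}$ be such that $r+s\in\mathbb{N}$ and $r+s\ge 2$. Around $t=2-r-s$, we have $$\Theta(r,s,t,x)=(-1)^{r+s}x^{s-1}(r+s-2)!\,\Gamma(1-r)\Gamma(1-s)+\sum_{k=0}^{r+s-2}\binom{r+s-2}{k}x^{r+s-2-k}\zeta(r-k)\zeta(k-r+2)+O\left(|t-(2-r-s)|\right).$$
   Context: $\mathbb{N}=\{1,2,3,\dots\}$. For $x>0$ and $(r,s,t)\in\mathbb{C}^3$ with $\Re(r+t)>1$, $\Re(s+t)>1$, $\Re(r+s+t)>2$, the generalized Mordell–Tornheim zeta function is the absolutely convergent series $\Theta(r,s,t,x)=\sum_{n=1}^{\infty}\sum_{m=1}^{\infty}\frac{1}{n^r m^s (n+mx)^t}$. For fixed $x>0$ it continues meromorphically to $(r,s,t)\in\mathbb{C}^3$, with singularities only on the hyperplanes $r+t=1-\ell$, $s+t=1-\ell$ ($\ell\in\mathbb{N}\cup\{0\}$) and $r+s+t=2$; $\Theta$ also denotes this continuation. For fixed $r,s$, it is considered as a meromorphic function of the single complex variable $t$; "around $t=t_0$" means as $t\to t_0$, $t\neq t_0$. $\zeta$ is the Riemann zeta function. *)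

theory Defs
  imports "HOL-Analysis.Analysis" "HOL-Library.Landau_Symbols"
begin

text \<open>
  The value of \<open>zeta\<close> at its pole \<open>1\<close> is left unspecified; everywhere else it is
  determined by the identity theorem, as \<open>\<complex> - {1}\<close> is connected.
\<close>

definition zeta :: "complex \<Rightarrow> complex" where
  "zeta = (SOME f. f holomorphic_on (- {1}) \<and>
             (\<forall>s. Re s > 1 \<longrightarrow> f s = (\<Sum>\<^sub>\<infinity>n\<in>{1::nat..}. 1 / of_nat n powr s)))"

text \<open>
  Holomorphic functions of three variables on an open set \<open>U\<close>: a complex-linear total
  derivative exists at every point of \<open>U\<close>.
\<close>

definition holomorphic3_on ::
    "(complex \<times> complex \<times> complex \<Rightarrow> complex) \<Rightarrow> (complex \<times> complex \<times> complex) set \<Rightarrow> bool" where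
  "holomorphic3_on F U \<longleftrightarrow>
     (\<forall>p\<in>U. \<exists>a b c. (F has_derivative (\<lambda>(h, k, l). a * h + b * k + c * l)) (at p))"

text \<open>
  \<open>F\<close> is a meromorphic function on \<open>\<complex>\<^sup>3\<close> whose singularities lie in the closed set \<open>S\<close>:
  it is holomorphic off \<open>S\<close>, and near every point it is a quotient of holomorphic
  functions with denominator not identically zero. The values of \<open>F\<close> on \<open>S\<close> are irrelevant.
\<close>

definition meromorphic3_sing ::
    "(complex \<times> complex \<times> complex \<Rightarrow> complex) \<Rightarrow> (complex \<times> complex \<times> complex) set \<Rightarrow> bool" where
  "meromorphic3_sing F S \<longleftrightarrow>
     holomorphic3_on F (- S) \<and>
     (\<forall>p. \<exists>U G H. open U \<and> connected U \<and> p \<in> U \<and>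
        holomorphic3_on G U \<and> holomorphic3_on H U \<and> (\<exists>q\<in>U. H q \<noteq> 0) \<and>
        (\<forall>q\<in>U - S. H q * F q = G q))"

definition MT_region :: "(complex \<times> complex \<times> complex) set" where
  "MT_region = {(r, s, t). Re (r + t) > 1 \<and> Re (s + t) > 1 \<and> Re (r + s + t) > 2}"

definition MT_hyperplanes :: "(complex \<times> complex \<times> complex) set" where
  "MT_hyperplanes =
     {(r, s, t). (\<exists>l::nat. r + t = 1 - of_nat l) \<or> (\<exists>l::nat. s + t = 1 - of_nat l) \<or> r + s + t = 2}"

definition MT_series :: "complex \<Rightarrow> complex \<Rightarrow> complex \<Rightarrow> real \<Rightarrow> complex" where
  "MT_series r s t x =
     (\<Sum>\<^sub>\<infinity>n\<in>{1::nat..}. \<Sum>\<^sub>\<infinity>m\<in>{1::nat..}.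
        1 / (of_nat n powr r * of_nat m powr s * of_real (real n + real m * x) powr t))"

text \<open>
  \<open>\<Theta>\<close> is the generalized Mordell--Tornheim zeta function. Off the hyperplanes it is uniquely
  determined by this predicate: every line parallel to the \<open>t\<close>-axis meets the region of
  convergence and meets the hyperplanes in a discrete set only.
\<close>

definition is_Mordell_Tornheim :: "(complex \<Rightarrow> complex \<Rightarrow> complex \<Rightarrow> real \<Rightarrow> complex) \<Rightarrow> bool" where
  "is_Mordell_Tornheim \<Theta> \<longleftrightarrow>
     (\<forall>x>0. meromorphic3_sing (\<lambda>(r, s, t). \<Theta> r s t x) MT_hyperplanes \<and>
            (\<forall>(r, s, t)\<in>MT_region. \<Theta> r s t x = MT_series r s t x))"

end

theory Submission
  imports Defs "HOL-Complex_Analysis.Complex_Analysis"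
begin

text \<open>
  For fixed \<open>r, s\<close> only the limit of \<open>\<Theta>\<close> at \<open>t = 2 - r - s\<close> matters: the singularity is then
  removable, and the error term follows. The recursion
  \<open>\<Theta>(r, s, t) = \<Theta>(r - 1, s, t + 1) + x \<Theta>(r, s - 1, t + 1)\<close> and Pascal's rule reduce the claim to
  \<open>r + s = 2\<close>, \<open>t \<rightarrow> 0\<close>. There, for real \<open>0 < s < 1\<close>, replace the sum over \<open>m\<close> by an integral over
  \<open>(0, \<infinity>)\<close>. The integral is a Beta function and contributes
  \<open>x\<^sup>s\<^sup>-\<^sup>1 \<Gamma>(1 - s) \<Gamma>(s + t - 1) \<zeta>(1 + t) / \<Gamma>(t)\<close>, whose pole is cancelled by \<open>1 / \<Gamma>(t)\<close>; the
  difference of sum and integral still converges near \<open>t = 0\<close>, with value \<open>\<zeta>(s)\<close> there. A Cauchy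
  integral around \<open>t = 0\<close> and the identity theorem in \<open>r\<close> extend this to all non-integral \<open>r\<close>.
\<close>

subsection \<open>Holomorphic integrals and series\<close>

text \<open>The point t = 2 - r - s lies on the hyperplane r + s + t = 2, where nothing is assumed
  about \<Theta>; only along lines with r + s fixed at an integer \<ge> 2 does a limit emerge. So a
  formula known for some r cannot be continued to other r at the point itself. The values on a small
  circle around it carry the information, and this circle has to miss the other two families of
  hyperplanes. For r + s = 2 and critical point t = 0, these come within distance d only if r is
  within d of an integer. Hence the continuation in r runs through convex domains (strips and
  half-planes) that keep a fixed distance from the integers, chained by their overlaps. The sign and
  the factorial of the claim are products of the recursion: lowering r or s multiplies the Gamma
  product by 1 - r or 1 - s, and these two factors add up to 2 - r - s, a negative integer once r +
  s > 2. As \<open>zeta\<close> is given by a choice operator, its continuation has to be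
  constructed. Beyond its series it is needed near its pole, for the main term, and on (0,1), as the
  value of a sum minus an integral; first-order Euler-Maclaurin supplies both.\<close>

lemma holomorphic_difference_bound:
  fixes f :: "complex \<Rightarrow> complex"
  assumes f: "f holomorphic_on ball a d" and bd: "\<And>z. z \<in> ball a d \<Longrightarrow> norm (f z) \<le> B"
    and d: "d > 0" and z: "z \<in> ball a (d/2)"
  shows "norm (f z - f a) \<le> 4 * B / d * norm (z - a)"
proof (rule field_differentiable_bound[where S = "ball a (d/2)" and f' = "deriv f"])
  fix w assume w: "w \<in> ball a (d/2)"
  \<comment> \<open>Every point of the half-size ball has room for a Cauchy circle of radius d/4;
    this is the origin of the factor 4 / d.\<close>
  have sub: "cball w (d/4) \<subseteq> ball a d"
  proof
    fix v assume "v \<in> cball w (d/4)"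
    thus "v \<in> ball a d"
      using w d dist_triangle[of a v w] by auto
  qed
  have "norm ((deriv ^^ 1) f w) \<le> fact 1 * B / (d/4) ^ 1"
  proof (rule Cauchy_inequality)
    show "f holomorphic_on ball w (d/4)" "continuous_on (cball w (d/4)) f"
      using sub ball_subset_cball[of w "d/4"]
      by (intro holomorphic_on_imp_continuous_on holomorphic_on_subset[OF f]; auto)+
    show "norm (f x) \<le> B" if "norm (w - x) = d/4" for x
      using that sub by (intro bd) (auto simp: dist_norm)
  qed (use d in auto)
  thus "norm (deriv f w) \<le> 4 * B / d" by (simp add: field_simps)
  have "w \<in> ball a d" using w d by auto
  thus "(f has_field_derivative deriv f w) (at w within ball a (d/2))"
    using f holomorphic_derivI[of f "ball a d" w] by auto
qed (use z d in auto)

text \<open>Differentiation under the integral with a majorant for the integrand only: by Cauchy's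
  inequality a local bound \<open>g\<close> for \<open>f\<close> bounds the difference quotients by
  \<open>4 * g y / d\<close>, so dominated convergence applies to them.\<close>

lemma holomorphic_on_integral_dominated:
  fixes f :: "complex \<Rightarrow> 'a \<Rightarrow> complex"
  assumes U: "open U"
    and hol: "\<And>y. y \<in> space M \<Longrightarrow> (\<lambda>z. f z y) holomorphic_on U"
    and meas: "\<And>z. z \<in> U \<Longrightarrow> f z \<in> borel_measurable M"
    and dom: "\<And>a. a \<in> U \<Longrightarrow> \<exists>d>0. \<exists>g. integrable M g \<and>
                 (\<forall>z\<in>ball a d. \<forall>y\<in>space M. norm (f z y) \<le> g y)"
  shows "(\<lambda>z. \<integral>y. f z y \<partial>M) holomorphic_on U"
  unfolding holomorphic_on_open[OF U]
proof
  fix a assume a: "a \<in> U"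
  obtain d0 g where d0: "d0 > 0" and g: "integrable M g"
    and bd0: "\<And>z y. z \<in> ball a d0 \<Longrightarrow> y \<in> space M \<Longrightarrow> norm (f z y) \<le> g y"
    using dom[OF a] by blast
  obtain d1 where d1: "d1 > 0" "ball a d1 \<subseteq> U"
    using U a by (auto simp: open_contains_ball)
  define d where "d = min d0 d1"
  have d: "d > 0" "ball a d \<subseteq> U" and bd: "\<And>z y. z \<in> ball a d \<Longrightarrow> y \<in> space M \<Longrightarrow> norm (f z y) \<le> g y"
    using d0 d1 bd0 by (auto simp: d_def)
  have int: "integrable M (f z)" if "z \<in> ball a d" for z
    by (rule Bochner_Integration.integrable_bound[OF g])
       (use meas that d bd in \<open>auto intro!: AE_I2 order_trans[OF bd abs_ge_self]\<close>)
  define f' where "f' y = deriv (\<lambda>z. f z y) a" for y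
  have q: "((\<lambda>z. (f z y - f a y) / (z - a)) \<longlongrightarrow> f' y) (at a)" if "y \<in> space M" for y
    using holomorphic_derivI[OF hol[OF that] U a] by (simp add: f'_def has_field_derivative_iff)
  \<comment> \<open>A sequence tending to \<open>a\<close> may start outside the ball where the
    majorant holds. Replacing these terms by a fixed point of the punctured ball does not affect
    limits.\<close>
  have seq_ball: "\<exists>X'. (\<forall>n. X' n \<in> ball a (d/2) - {a}) \<and> eventually (\<lambda>n. X n = X' n) sequentially"
    if "\<forall>n. X n \<noteq> a" "X \<longlonglongrightarrow> a" for X :: "nat \<Rightarrow> complex"
  proof -
    have ev: "eventually (\<lambda>n. X n \<in> ball a (d/2)) sequentially"
      using that(2) d by (intro topological_tendstoD) auto
    define X' where "X' n = (if X n \<in> ball a (d/2) then X n else a + of_real (d/4))" for n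
    have "X' n \<in> ball a (d/2) - {a}" for n
      using that d by (auto simp: X'_def dist_norm)
    moreover have "eventually (\<lambda>n. X n = X' n) sequentially"
      using ev by eventually_elim (auto simp: X'_def)
    ultimately show ?thesis by blast
  qed
  have Q: "(\<lambda>n. \<integral>y. (f (X n) y - f a y) / (X n - a) \<partial>M) \<longlonglongrightarrow> (\<integral>y. f' y \<partial>M)"
    if X: "\<And>n. X n \<in> ball a (d/2) - {a}" "X \<longlonglongrightarrow> a" for X :: "nat \<Rightarrow> complex"
  proof (rule integral_dominated_convergence[where w = "\<lambda>y. 4 * g y / d"])
    have mX: "(\<lambda>y. (f (X n) y - f a y) / (X n - a)) \<in> borel_measurable M" for n
    proof -
      have "X n \<in> U" using X(1)[of n] d by auto
      thus ?thesis using meas[of "X n"] meas[OF a] by measurable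
    qed
    show "(\<lambda>y. (f (X n) y - f a y) / (X n - a)) \<in> borel_measurable M" for n by (rule mX)
    have lim: "(\<lambda>n. (f (X n) y - f a y) / (X n - a)) \<longlonglongrightarrow> f' y" if "y \<in> space M" for y
      using q[OF that] X unfolding tendsto_at_iff_sequentially comp_def by auto
    show "AE y in M. (\<lambda>n. (f (X n) y - f a y) / (X n - a)) \<longlonglongrightarrow> f' y"
      using lim by (intro AE_I2)
    show "f' \<in> borel_measurable M"
      by (rule borel_measurable_LIMSEQ_metric[OF mX lim])
    show "integrable M (\<lambda>y. 4 * g y / d)" using g by simp
    show "AE y in M. norm ((f (X n) y - f a y) / (X n - a)) \<le> 4 * g y / d" for n
    proof (intro AE_I2)
      fix y assume y: "y \<in> space M"
      have "norm (f (X n) y - f a y) \<le> 4 * g y / d * norm (X n - a)"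
        by (rule holomorphic_difference_bound[of "\<lambda>z. f z y" a d "g y"])
           (use X(1)[of n] y d bd in \<open>auto intro: holomorphic_on_subset[OF hol]\<close>)
      thus "norm ((f (X n) y - f a y) / (X n - a)) \<le> 4 * g y / d"
        using X(1)[of n] by (simp add: norm_divide divide_le_eq)
    qed
  qed
  have "((\<lambda>z. ((\<integral>y. f z y \<partial>M) - (\<integral>y. f a y \<partial>M)) / (z - a)) \<longlongrightarrow> (\<integral>y. f' y \<partial>M)) (at a)"
    unfolding tendsto_at_iff_sequentially comp_def
  proof (intro allI impI)
    fix X assume X: "\<forall>i. X i \<in> UNIV - {a}" "X \<longlonglongrightarrow> a"
    obtain X' where X': "\<And>n. X' n \<in> ball a (d/2) - {a}" "eventually (\<lambda>n. X n = X' n) sequentially"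
      using seq_ball[of X] X by auto
    have "X' \<longlonglongrightarrow> a" using X(2) X'(2) by (rule Lim_transform_eventually)
    from Q[OF X'(1) this]
    have "(\<lambda>n. \<integral>y. (f (X' n) y - f a y) / (X' n - a) \<partial>M) \<longlonglongrightarrow> (\<integral>y. f' y \<partial>M)" .
    moreover have "(\<integral>y. (f (X' n) y - f a y) / (X' n - a) \<partial>M)
        = ((\<integral>y. f (X' n) y \<partial>M) - (\<integral>y. f a y \<partial>M)) / (X' n - a)" for n
    proof -
      have "X' n \<in> ball a d" "a \<in> ball a d" using X'(1)[of n] d by auto
      thus ?thesis using int by simp
    qed
    ultimately have "(\<lambda>n. ((\<integral>y. f (X' n) y \<partial>M) - (\<integral>y. f a y \<partial>M)) / (X' n - a)) \<longlonglongrightarrow> (\<integral>y. f' y \<partial>M)"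
      by (simp only:)
    thus "(\<lambda>n. ((\<integral>y. f (X n) y \<partial>M) - (\<integral>y. f a y \<partial>M)) / (X n - a)) \<longlonglongrightarrow> (\<integral>y. f' y \<partial>M)"
      by (rule Lim_transform_eventually) (use X'(2) in \<open>eventually_elim; simp\<close>)
  qed
  thus "\<exists>f'. ((\<lambda>z. \<integral>y. f z y \<partial>M) has_field_derivative f') (at a)"
    unfolding has_field_derivative_iff by blast
qed

text \<open>Joint continuity on the compact product of a closed disc and the interval bounds the
  integrand by a constant, which serves as local majorant.\<close>

lemma holomorphic_on_integral_interval:
  fixes f :: "complex \<Rightarrow> real \<Rightarrow> complex"
  assumes U: "open U" and cont: "continuous_on (U \<times> {a..b}) (\<lambda>(z, y). f z y)"
    and hol: "\<And>y. y \<in> {a..b} \<Longrightarrow> (\<lambda>z. f z y) holomorphic_on U"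
  shows "(\<lambda>z. integral {a..b} (f z)) holomorphic_on U"
proof -
  have conty: "continuous_on {a..b} (f z)" if "z \<in> U" for z
  proof -
    have "continuous_on {a..b} (\<lambda>y. (\<lambda>(z, y). f z y) (z, y))"
      by (rule continuous_on_compose2[OF cont continuous_on_Pair[OF continuous_on_const continuous_on_id]])
         (use that in auto)
    thus ?thesis by simp
  qed
  have "(\<lambda>z. \<integral>y. indicator {a..b} y *\<^sub>R f z y \<partial>lborel) holomorphic_on U"
  proof (rule holomorphic_on_integral_dominated[OF U])
    show "(\<lambda>z. indicator {a..b} y *\<^sub>R f z y) holomorphic_on U" for y
      using hol[of y] by (cases "y \<in> {a..b}") auto
    show "(\<lambda>y. indicator {a..b} y *\<^sub>R f z y) \<in> borel_measurable lborel" if "z \<in> U" for z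
      using borel_measurable_continuous_on_indicator[OF _ conty[OF that]] by auto
    fix c assume "c \<in> U"
    then obtain e where e: "e > 0" "cball c e \<subseteq> U"
      using U by (auto simp: open_contains_cball)
    have "compact ((\<lambda>(z,y). f z y) ` (cball c e \<times> {a..b}))"
      by (intro compact_continuous_image continuous_on_subset[OF cont] compact_Times)
         (use e in auto)
    from compact_imp_bounded[OF this]
    obtain B where B: "\<And>z y. z \<in> cball c e \<Longrightarrow> y \<in> {a..b} \<Longrightarrow> norm (f z y) \<le> B"
      unfolding bounded_iff by force
    have "integrable lborel (\<lambda>y. indicator {a..b} y *\<^sub>R B)"
      using integrable_real_indicator[of "{a..b}" lborel] by (auto simp: emeasure_lborel_Icc_eq)
    moreover have "norm (indicator {a..b} y *\<^sub>R f z y) \<le> indicator {a..b} y *\<^sub>R B"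
      if "z \<in> ball c e" for z y
      using B[of z y] that by (auto simp: indicator_def)
    ultimately show "\<exists>d>0. \<exists>g. integrable lborel g \<and>
        (\<forall>z\<in>ball c d. \<forall>y\<in>space lborel. norm (indicator {a..b} y *\<^sub>R f z y) \<le> g y)"
      using e(1) by blast
  qed
  moreover have "(\<integral>y. indicator {a..b} y *\<^sub>R f z y \<partial>lborel) = integral {a..b} (f z)" if "z \<in> U" for z
    using set_borel_integral_eq_integral(2)[OF borel_integrable_atLeastAtMost'[OF conty[OF that]]]
    by (simp add: set_lebesgue_integral_def)
  ultimately show ?thesis
    using holomorphic_cong[of U U] by (metis (no_types, lifting))
qed

lemma uniform_limit_imp_holomorphic_on:
  fixes f :: "'i \<Rightarrow> complex \<Rightarrow> complex"
  assumes U: "open U" and hol: "eventually (\<lambda>n. f n holomorphic_on U) F"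
    and lim: "\<And>a. a \<in> U \<Longrightarrow> \<exists>d>0. uniform_limit (ball a d) f g F" and F: "F \<noteq> bot"
  shows "g holomorphic_on U"
  unfolding holomorphic_on_open[OF U]
proof
  fix a assume a: "a \<in> U"
  obtain d where d: "d > 0" "uniform_limit (ball a d) f g F" using lim[OF a] by blast
  obtain e where e: "e > 0" "cball a e \<subseteq> U" using U a by (auto simp: open_contains_cball)
  define r where "r = min e (d/2)"
  have r: "r > 0" "cball a r \<subseteq> U" "cball a r \<subseteq> ball a d"
    using d e by (auto simp: r_def)
  have "g holomorphic_on ball a r"
  proof (rule holomorphic_uniform_limit)
    show "uniform_limit (cball a r) f g F" using d(2) r(3) by (rule uniform_limit_on_subset)
    show "\<forall>\<^sub>F n in F. continuous_on (cball a r) (f n) \<and> f n holomorphic_on ball a r"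
      using hol
    proof eventually_elim
      case (elim n)
      thus ?case using r(2) ball_subset_cball[of a r]
        by (intro conjI holomorphic_on_imp_continuous_on; elim holomorphic_on_subset) auto
    qed
  qed (use F in auto)
  thus "\<exists>f'. (g has_field_derivative f') (at a)"
    using r(1) by (meson centre_in_ball holomorphic_on_open open_ball)
qed

lemma holomorphic_on_infsum_dominated:
  fixes f :: "'i \<Rightarrow> complex \<Rightarrow> complex"
  assumes U: "open U" and hol: "\<And>n. n \<in> A \<Longrightarrow> f n holomorphic_on U"
    and dom: "\<And>a. a \<in> U \<Longrightarrow> \<exists>d>0. \<exists>B. B summable_on A \<and> (\<forall>z\<in>ball a d. \<forall>n\<in>A. norm (f n z) \<le> B n)"
  shows "(\<lambda>z. \<Sum>\<^sub>\<infinity>n\<in>A. f n z) holomorphic_on U"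
proof (rule uniform_limit_imp_holomorphic_on[OF U])
  show "\<exists>d>0. uniform_limit (ball a d) (\<lambda>X z. \<Sum>n\<in>X. f n z) (\<lambda>z. \<Sum>\<^sub>\<infinity>n\<in>A. f n z) (finite_subsets_at_top A)"
    if a: "a \<in> U" for a
  proof -
    obtain d B where "d > 0" "B summable_on A" "\<forall>z\<in>ball a d. \<forall>n\<in>A. norm (f n z) \<le> B n"
      using dom[OF a] by blast
    thus ?thesis by (intro exI[of _ d] conjI Weierstrass_m_test_general[of A _ f B]) auto
  qed
  show "\<forall>\<^sub>F X in finite_subsets_at_top A. (\<lambda>z. \<Sum>n\<in>X. f n z) holomorphic_on U"
    by (intro eventually_finite_subsets_at_top_weakI holomorphic_on_sum hol) auto
qed auto

lemma tendsto_holomorphic_imp_bigo: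
  fixes f :: "complex \<Rightarrow> complex"
  assumes "open A" "a \<in> A" "f holomorphic_on A - {a}" "(f \<longlongrightarrow> c) (at a)"
  shows "(\<lambda>z. f z - c) \<in> O[at a](\<lambda>z. z - a)"
proof -
  define g where "g z = (if z = a then c else f z)" for z
  have "g holomorphic_on A"
    unfolding g_def using assms by (intro removable_singularity) auto
  hence "((\<lambda>z. (g z - g a) / (z - a)) \<longlongrightarrow> deriv g a) (at a)"
    using holomorphic_derivI[of g A a] assms by (simp add: has_field_derivative_iff)
  hence "(\<lambda>z. g z - g a) \<in> O[at a](\<lambda>z. z - a)"
    by (rule bigoI_tendsto) (auto simp: eventually_at_filter)
  also have "?this \<longleftrightarrow> ?thesis"
    by (intro landau_o.big.in_cong) (auto simp: eventually_at_filter g_def)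
  finally show ?thesis .
qed

subsection \<open>The Riemann zeta function\<close>

lemma norm_of_real_powr: "u > 0 \<Longrightarrow> norm (complex_of_real u powr z) = u powr Re z"
  by (simp add: norm_powr_real_powr)

lemma real_powr_summable_on:
  fixes A :: "nat set"
  assumes "p < -1" shows "(\<lambda>n. real n powr p) summable_on A"
proof -
  have "(\<lambda>n. real n powr p) summable_on UNIV"
    using assms by (intro norm_summable_imp_summable_on) (simp add: summable_real_powr_iff)
  thus ?thesis by (rule summable_on_subset_banach) simp
qed

lemma Suc_powr_summable_on:
  assumes "p < -1" shows "(\<lambda>n. (1 + real n) powr p) summable_on UNIV"
proof -
  have "summable (\<lambda>n. real (Suc n) powr p)"
    using assms by (subst summable_Suc_iff) (simp add: summable_real_powr_iff)
  thus ?thesis by (intro norm_summable_imp_summable_on) simp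
qed

text \<open>
  \<open>scaled_hurwitz k s a\<close> is \<open>s - 1\<close> times the Hurwitz zeta function on \<open>Re s > 1 - k\<close>; the recursion
  is the first-order Euler--Maclaurin formula.
\<close>

fun scaled_hurwitz :: "nat \<Rightarrow> complex \<Rightarrow> real \<Rightarrow> complex" where
  "scaled_hurwitz 0 s a = (s - 1) * (\<Sum>\<^sub>\<infinity>n\<in>UNIV. of_real (real n + a) powr (- s))"
| "scaled_hurwitz (Suc k) s a = of_real a powr (1 - s)
      + (s - 1) * integral {0..1} (\<lambda>v. (1 - of_real v) * scaled_hurwitz k (s + 1) (a + v))"

lemma norm_hurwitz_term_le:
  assumes "a \<ge> 1" "Re s \<ge> p" "p \<ge> 0"
  shows "norm (complex_of_real (real n + a) powr (- s)) \<le> (1 + real n) powr (- p)"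
proof -
  have "norm (complex_of_real (real n + a) powr (- s)) = (real n + a) powr (- Re s)"
    using assms by (subst norm_of_real_powr) auto
  also have "\<dots> \<le> (real n + a) powr (- p)"
    using assms by (intro powr_mono) auto
  also have "\<dots> \<le> (1 + real n) powr (- p)"
    using assms by (intro powr_mono2') auto
  finally show ?thesis .
qed

lemma hurwitz_uniform_limit:
  assumes "p > 1"
  shows "uniform_limit ({s. Re s \<ge> p} \<times> {1..})
      (\<lambda>X sa. \<Sum>n\<in>X. complex_of_real (real n + snd sa) powr (- fst sa))
      (\<lambda>sa. \<Sum>\<^sub>\<infinity>n\<in>UNIV. complex_of_real (real n + snd sa) powr (- fst sa))
      (finite_subsets_at_top UNIV)"
proof (rule Weierstrass_m_test_general[where M = "\<lambda>n. (1 + real n) powr (- p)"])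
  show "(\<lambda>n. (1 + real n) powr (- p)) summable_on UNIV"
    using assms by (intro Suc_powr_summable_on) auto
qed (use assms in \<open>auto intro!: norm_hurwitz_term_le simp del: of_real_add\<close>)

lemma open_Re_gt: "open {s. Re s > c}"
  using open_halfspace_Re_gt[of c] by simp

text \<open>Continuity is needed jointly in \<open>s\<close> and \<open>a\<close>, because the
  recursion integrates over shifts of \<open>a\<close> while \<open>s\<close> varies. This is also
  why the majorant of the series is uniform in \<open>a \<ge> 1\<close>.\<close>

lemma continuous_on_scaled_hurwitz:
  "continuous_on ({s. Re s > 1 - real k} \<times> {1..}) (\<lambda>sa. scaled_hurwitz k (fst sa) (snd sa))"
proof (induction k)
  case 0
  let ?S = "\<lambda>sa. \<Sum>\<^sub>\<infinity>n\<in>UNIV. complex_of_real (real n + snd sa) powr (- fst sa)"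
  have "continuous (at sa within {s. Re s > 1} \<times> {1..}) ?S" if sa: "sa \<in> {s. Re s > 1} \<times> {1..}" for sa
  proof -
    \<comment> \<open>The convergence is uniform only on half-planes Re s \<ge> p with p > 1; the
      midpoint leaves a neighbourhood of \<open>sa\<close> inside one of them.\<close>
    define p where "p = (1 + Re (fst sa)) / 2"
    have p: "p > 1" "Re (fst sa) > p" using sa by (auto simp: p_def)
    let ?T = "{s. Re s \<ge> p} \<times> {1..}"
    have "continuous_on ?T ?S"
      by (rule uniform_limit_theorem[OF _ hurwitz_uniform_limit[OF p(1)]])
         (auto intro!: always_eventually continuous_intros simp: complex_nonpos_Reals_iff simp del: of_real_add)
    hence "continuous (at sa within ?T) ?S"
      using sa p by (auto simp: continuous_on_eq_continuous_within)
    also have "at sa within ?T = at sa within ({s. Re s > 1} \<times> {1..})"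
    proof (rule at_within_nhd[where S = "{s. Re s > p} \<times> UNIV"])
      show "open ({s. p < Re s} \<times> (UNIV :: real set))" by (intro open_Times open_Re_gt) auto
    qed (use sa p in auto)
    finally show ?thesis .
  qed
  hence "continuous_on ({s. Re s > 1} \<times> {1..}) ?S"
    by (simp only: continuous_on_eq_continuous_within) blast
  thus ?case by (auto intro!: continuous_intros)
next
  case (Suc k)
  have "continuous_on (({s. Re s > - real k} \<times> {1..}) \<times> cbox 0 1)
     (\<lambda>(sa, v). (1 - complex_of_real v) * scaled_hurwitz k (fst sa + 1) (snd sa + v))"
    unfolding case_prod_unfold
    by (intro continuous_intros continuous_on_compose2[OF Suc, of _ "\<lambda>x. (fst (fst x) + 1, snd (fst x) + snd x)", simplified])
       auto
  from integral_continuous_on_param[OF this]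
  show ?case by (auto intro!: continuous_intros simp: complex_nonpos_Reals_iff)
qed

lemma scaled_hurwitz_integrand_continuous:
  assumes "a \<ge> 1"
  shows "continuous_on ({s. Re s > - real k} \<times> {0..1})
           (\<lambda>(s, v). (1 - complex_of_real v) * scaled_hurwitz k (s + 1) (a + v))"
  unfolding case_prod_unfold using assms
  by (intro continuous_intros continuous_on_compose2[OF continuous_on_scaled_hurwitz, of _ "\<lambda>x. (fst x + 1, a + snd x)" k, simplified])
     auto

lemma holomorphic_scaled_hurwitz:
  assumes "a \<ge> 1"
  shows "(\<lambda>s. scaled_hurwitz k s a) holomorphic_on {s. Re s > 1 - real k}"
  using assms
proof (induction k arbitrary: a)
  case 0
  have "(\<lambda>s. \<Sum>\<^sub>\<infinity>n\<in>UNIV. complex_of_real (real n + a) powr (- s)) holomorphic_on {s. Re s > 1}"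
  proof (rule holomorphic_on_infsum_dominated[OF open_Re_gt])
    fix n show "(\<lambda>s. complex_of_real (real n + a) powr (- s)) holomorphic_on {s. Re s > 1}"
      using 0 by (intro holomorphic_intros) (auto simp: complex_nonpos_Reals_iff)
  next
    fix s0 assume s0: "s0 \<in> {s. Re s > 1}"
    define p where "p = (1 + Re s0) / 2"
    have p: "p > 1" "Re s0 > p" using s0 by (auto simp: p_def)
    have "norm (complex_of_real (real n + a) powr (- s)) \<le> (1 + real n) powr (- p)"
      if "s \<in> ball s0 (Re s0 - p)" for s n
    proof (rule norm_hurwitz_term_le)
      have "\<bar>Re s0 - Re s\<bar> < Re s0 - p"
        using that abs_Re_le_cmod[of "s0 - s"] by (auto simp: dist_norm)
      thus "p \<le> Re s" by auto
    qed (use 0 p in auto)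
    moreover have "(\<lambda>n. (1 + real n) powr (- p)) summable_on UNIV"
      using p by (intro Suc_powr_summable_on) auto
    ultimately show "\<exists>d>0. \<exists>B. B summable_on UNIV \<and>
        (\<forall>z\<in>ball s0 d. \<forall>n\<in>UNIV. norm (complex_of_real (real n + a) powr (- z)) \<le> B n)"
      using p by (intro exI[of _ "Re s0 - p"] conjI exI[of _ "\<lambda>n. (1 + real n) powr (- p)"]) auto
  qed
  thus ?case by (auto intro!: holomorphic_intros)
next
  case (Suc k)
  have "(\<lambda>s. integral {0..1} (\<lambda>v. (1 - of_real v) * scaled_hurwitz k (s + 1) (a + v))) holomorphic_on {s. Re s > - real k}"
  proof (rule holomorphic_on_integral_interval[OF open_Re_gt scaled_hurwitz_integrand_continuous[OF Suc.prems]])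
    fix v :: real assume v: "v \<in> {0..1}"
    have "(\<lambda>s. scaled_hurwitz k s (a + v)) \<circ> (\<lambda>s. s + 1) holomorphic_on {s. Re s > - real k}"
      using Suc v by (intro holomorphic_on_compose_gen[OF _ Suc.IH] holomorphic_intros) auto
    thus "(\<lambda>s. (1 - of_real v) * scaled_hurwitz k (s + 1) (a + v)) holomorphic_on {s. Re s > - real k}"
      by (intro holomorphic_intros) (simp add: o_def)
  qed
  thus ?case using Suc.prems by (auto intro!: holomorphic_intros simp: complex_nonpos_Reals_iff)
qed

section \<open>First-order Euler-Maclaurin summation of powers\<close>

lemma euler_maclaurin_power:
  fixes s :: complex and z :: real
  assumes z: "z > 0" and s: "s \<noteq> 1"
  shows "((\<lambda>v. (1 - of_real v) * (s * of_real (z + v) powr (- (s + 1)))) has_integral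
           of_real z powr (- s) - (of_real z powr (1 - s) - of_real (z + 1) powr (1 - s)) / (s - 1)) {0..1}"
proof -
  have e: "- (s + 1) = - s - 1" by simp
  define c where "c = 1 / (1 - s)"
  have c: "c * (1 - s) = 1" using s by (simp add: c_def)
  \<comment> \<open>Primitive found by integrating by parts: the first term differentiates to the
    integrand plus (z + V)^(-s), and the second term removes this surplus. It is a function of a
    complex variable so that complex derivative rules apply before restricting to real
    \<open>v\<close>.\<close>
  define G where "G V = - (1 - V) * (of_real z + V) powr (- s) - c * (of_real z + V) powr (1 - s)" for V
  have "((\<lambda>v. (1 - of_real v) * (s * of_real (z + v) powr (- (s + 1)))) has_integral
           G (of_real 1) - G (of_real 0)) {0..1}"
  proof (rule fundamental_theorem_of_calculus)
    fix v :: real assume v: "v \<in> {0..1}"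
    have nz: "of_real z + complex_of_real v \<notin> \<real>\<^sub>\<le>\<^sub>0"
      using v z by (auto simp: complex_nonpos_Reals_iff)
    let ?P = "\<lambda>w. complex_of_real (z + v) powr w"
    have D: "(G has_field_derivative ?P (- s) + (1 - of_real v) * (s * ?P (- s - 1)) - c * ((1 - s) * ?P (- s))) (at (of_real v))"
      unfolding G_def using nz
      by (auto intro!: derivative_eq_intros simp: algebra_simps)
    have P: "c * ((1 - s) * ?P (- s)) = ?P (- s)"
      using c by (simp only: mult.assoc[symmetric]) simp
    have "(G has_field_derivative (1 - of_real v) * (s * of_real (z + v) powr (- (s + 1)))) (at (of_real v))"
      using D unfolding P e by simp
    thus "((\<lambda>v. G (of_real v)) has_vector_derivative (1 - of_real v) * (s * of_real (z + v) powr (- (s + 1))))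
        (at v within {0..1})"
      by (rule has_vector_derivative_real_field)
  qed auto
  moreover have div: "w / (s - 1) = - (c * w)" for w
    by (simp add: c_def) (metis minus_diff_eq minus_divide_right)
  have "G (of_real 1) - G (of_real 0) =
      of_real z powr (- s) - (of_real z powr (1 - s) - of_real (z + 1) powr (1 - s)) / (s - 1)"
    unfolding div by (simp add: G_def algebra_simps)
  ultimately show ?thesis by simp
qed

text \<open>The prefactor of \<open>scaled_hurwitz 0 (s + 1)\<close> is (s + 1) - 1 = s, which is
  just the factor in \<open>euler_maclaurin_power\<close>. The series at s + 1 converges uniformly
  in \<open>v\<close> as soon as Re s > 0, so termwise integration reaches beyond the half-plane of
  convergence of the zeta series.\<close>

lemma scaled_hurwitz_integral_has_sum:
  assumes a: "a \<ge> 1" and s: "Re s > 0" "s \<noteq> 1"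
  shows "((\<lambda>n. of_real (real n + a) powr (- s) -
            (of_real (real n + a) powr (1 - s) - of_real (real n + a + 1) powr (1 - s)) / (s - 1))
           has_sum integral {0..1} (\<lambda>v. (1 - of_real v) * scaled_hurwitz 0 (s + 1) (a + v))) UNIV"
proof -
  let ?f = "\<lambda>n v. (1 - of_real v) * (s * complex_of_real (real n + a + v) powr (- (s + 1)))"
  let ?F = "finite_subsets_at_top (UNIV :: nat set)"
  have lim: "uniform_limit (cbox 0 1) (\<lambda>X v. \<Sum>n\<in>X. ?f n v) (\<lambda>v. \<Sum>\<^sub>\<infinity>n\<in>UNIV. ?f n v) ?F"
  proof (rule Weierstrass_m_test_general[where M = "\<lambda>n. norm s * (1 + real n) powr (- (Re s + 1))"])
    show "(\<lambda>n. norm s * (1 + real n) powr (- (Re s + 1))) summable_on UNIV"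
      using s by (intro summable_on_cmult_right Suc_powr_summable_on) auto
    fix n v assume v: "v \<in> cbox 0 (1::real)"
    have "norm (1 - complex_of_real v) = \<bar>1 - v\<bar>"
      by (metis norm_of_real of_real_1 of_real_diff)
    hence "norm (?f n v) \<le> 1 * (norm s * (1 + real n) powr (- (Re s + 1)))"
      using v a s norm_hurwitz_term_le[of "a + v" "Re s + 1" "s + 1" n] unfolding norm_mult
      by (intro mult_mono) (auto simp: add_ac)
    thus "norm (?f n v) \<le> norm s * (1 + real n) powr (- (Re s + 1))" by simp
  qed
  obtain I J where IJ: "\<And>X. ((\<lambda>v. \<Sum>n\<in>X. ?f n v) has_integral I X) (cbox 0 1)"
     "((\<lambda>v. \<Sum>\<^sub>\<infinity>n\<in>UNIV. ?f n v) has_integral J) (cbox 0 1)" "(I \<longlongrightarrow> J) ?F"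
    by (rule uniform_limit_integral_cbox[OF lim])
       (use a in \<open>auto intro!: continuous_intros simp: complex_nonpos_Reals_iff simp del: of_real_add\<close>)
  have J: "J = integral {0..1} (\<lambda>v. (1 - of_real v) * scaled_hurwitz 0 (s + 1) (a + v))"
    using IJ(2) by (simp add: integral_unique infsum_cmult_right' add_ac)
  let ?c = "\<lambda>n. of_real (real n + a) powr (- s) -
            (of_real (real n + a) powr (1 - s) - complex_of_real (real n + a + 1) powr (1 - s)) / (s - 1)"
  have "I X = sum ?c X" if "finite X" for X
  proof (rule has_integral_unique[OF IJ(1)])
    show "((\<lambda>v. \<Sum>n\<in>X. ?f n v) has_integral sum ?c X) (cbox 0 1)"
      using a s that by (intro has_integral_sum, simp) (use euler_maclaurin_power[of "real n + a" s for n] in auto)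
  qed
  hence "(sum ?c \<longlongrightarrow> J) ?F"
    by (intro Lim_transform_eventually[OF IJ(3)] eventually_finite_subsets_at_top_weakI)
  thus ?thesis by (simp add: has_sum_def J)
qed

text \<open>Consecutive levels agree where both are meaningful, so they glue to one function. At
  level 0 the differences of powers telescope to the boundary term a^(1 - s), as Re s > 1; higher
  levels inherit the identity under the integral.\<close>

lemma scaled_hurwitz_Suc_eq:
  assumes "a \<ge> 1" "Re s > 1 - real k"
  shows "scaled_hurwitz (Suc k) s a = scaled_hurwitz k s a"
  using assms
proof (induction k arbitrary: s a)
  case 0
  have s: "Re s > 1" "s \<noteq> 1" using 0 by auto
  define J where "J = integral {0..1} (\<lambda>v. (1 - of_real v) * scaled_hurwitz 0 (s + 1) (a + v))"
  have 1: "(\<lambda>n. of_real (real n + a) powr (- s) -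
            (of_real (real n + a) powr (1 - s) - of_real (real n + a + 1) powr (1 - s)) / (s - 1)) sums J"
    unfolding J_def using 0 s by (intro has_sum_imp_sums scaled_hurwitz_integral_has_sum) auto
  have "(\<lambda>n. complex_of_real (real n + a) powr (- s)) summable_on UNIV"
    by (rule abs_summable_summable, rule Infinite_Sum.abs_summable_on_comparison_test'[OF Suc_powr_summable_on[of "- Re s"]])
       (use 0 s norm_hurwitz_term_le[of a "Re s" s] in \<open>auto simp del: of_real_add\<close>)
  hence 2: "(\<lambda>n. complex_of_real (real n + a) powr (- s)) sums
              (\<Sum>\<^sub>\<infinity>n\<in>UNIV. complex_of_real (real n + a) powr (- s))"
    by (intro has_sum_imp_sums has_sum_infsum)
  have "(\<lambda>n. complex_of_real (real n + a) powr (1 - s)) \<longlonglongrightarrow> 0"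
  proof (rule tendsto_norm_zero_cancel)
    have "(\<lambda>n. (real n + a) powr (1 - Re s)) \<longlonglongrightarrow> 0"
      using s tendsto_neg_powr[OF _ filterlim_tendsto_add_at_top[OF tendsto_const[of a] filterlim_real_sequentially], of "1 - Re s"]
      by (simp add: add.commute)
    thus "(\<lambda>n. norm (complex_of_real (real n + a) powr (1 - s))) \<longlonglongrightarrow> 0"
      using 0 by (subst norm_of_real_powr) auto
  qed
  from telescope_sums'[OF this]
  have 3: "(\<lambda>n. of_real (real n + a) powr (1 - s) - complex_of_real (real n + a + 1) powr (1 - s)) sums
              (of_real a powr (1 - s))"
    by (simp add: add_ac)
  have J: "J = (\<Sum>\<^sub>\<infinity>n\<in>UNIV. complex_of_real (real n + a) powr (- s)) - of_real a powr (1 - s) / (s - 1)"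
    by (rule sums_unique2[OF 1 sums_diff[OF 2 sums_divide[OF 3]]])
  have "scaled_hurwitz (Suc 0) s a = of_real a powr (1 - s) + (s - 1) * J"
    by (simp only: scaled_hurwitz.simps(2) J_def)
  also have "\<dots> = scaled_hurwitz 0 s a"
    unfolding J scaled_hurwitz.simps(1) using s by (simp add: right_diff_distrib)
  finally show ?case .
next
  case (Suc k)
  have "integral {0..1} (\<lambda>v. (1 - of_real v) * scaled_hurwitz (Suc k) (s + 1) (a + v)) =
        integral {0..1} (\<lambda>v. (1 - of_real v) * scaled_hurwitz k (s + 1) (a + v))"
    using Suc by (intro integral_cong arg_cong2[of _ _ _ _ "(*)"] refl Suc.IH) auto
  thus ?case by (simp only: scaled_hurwitz.simps)
qed

declare scaled_hurwitz.simps [simp del]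

lemma scaled_hurwitz_0_eq_zeta_series:
  "scaled_hurwitz 0 s 1 = (s - 1) * (\<Sum>\<^sub>\<infinity>n\<in>{1::nat..}. 1 / of_nat n powr s)"
proof -
  have "(\<Sum>\<^sub>\<infinity>n\<in>{1::nat..}. 1 / of_nat n powr s) = (\<Sum>\<^sub>\<infinity>n\<in>UNIV. 1 / of_nat (Suc n) powr s)"
    by (rule infsum_reindex_bij_betw[symmetric, of Suc])
       (auto simp: bij_betw_def image_iff Suc_le_eq gr0_conv_Suc)
  thus ?thesis by (simp add: scaled_hurwitz.simps powr_minus_divide add_ac)
qed

text \<open>Since \<open>zeta\<close> is chosen by \<open>SOME\<close>, both properties rest on
  exhibiting one function that has them.\<close>

lemma zeta_holomorphic: "zeta holomorphic_on - {1}"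
  and zeta_eq_series: "Re s > 1 \<Longrightarrow> zeta s = (\<Sum>\<^sub>\<infinity>n\<in>{1::nat..}. 1 / of_nat n powr s)"
proof -
  \<comment> \<open>This level k satisfies k \<ge> 2 - Re s, hence Re s > 1 - k; any other
    admissible level gives the same value.\<close>
  define f where "f s = scaled_hurwitz (nat \<lceil>2 - Re s\<rceil>) s 1 / (s - 1)" for s
  have add: "scaled_hurwitz (k + j) s 1 = scaled_hurwitz k s 1" if "Re s > 1 - real k" for k j s
  proof (induction j)
    case (Suc j)
    thus ?case using scaled_hurwitz_Suc_eq[of 1 "k + j" s] that by simp
  qed simp
  have f: "f s = scaled_hurwitz k s 1 / (s - 1)" if "Re s > 1 - real k" for k s
  proof -
    let ?m = "nat \<lceil>2 - Re s\<rceil>"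
    have "Re s > 1 - real ?m" by linarith
    hence "scaled_hurwitz ?m s 1 = scaled_hurwitz (?m + k) s 1" by (rule add[symmetric])
    also have "\<dots> = scaled_hurwitz k s 1" using add[OF that, of ?m] by (simp add: add_ac)
    finally show ?thesis by (simp add: f_def)
  qed
  have "f holomorphic_on (\<Union>k\<in>UNIV. {s. Re s > 1 - real k} - {1})"
  proof (rule holomorphic_on_UN_open)
    fix k :: nat
    have "(\<lambda>s. scaled_hurwitz k s 1 / (s - 1)) holomorphic_on {s. Re s > 1 - real k} - {1}"
      by (intro holomorphic_intros holomorphic_on_subset[OF holomorphic_scaled_hurwitz]) auto
    thus "f holomorphic_on {s. Re s > 1 - real k} - {1}"
      by (rule holomorphic_transform) (auto simp: f)
    show "open ({s. Re s > 1 - real k} - {1})" by (intro open_delete open_Re_gt)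
  qed
  also have "(\<Union>k\<in>UNIV. {s. Re s > 1 - real k} - {1}) = - {1}"
  proof -
    have "\<exists>k. Re s > 1 - real k" for s
      using reals_Archimedean2[of "1 - Re s"] by (auto simp: algebra_simps)
    thus ?thesis by auto
  qed
  finally have "f holomorphic_on - {1}" .
  moreover have "f s = (\<Sum>\<^sub>\<infinity>n\<in>{1::nat..}. 1 / of_nat n powr s)" if "Re s > 1" for s
    using f[of 0 s] that by (auto simp: scaled_hurwitz_0_eq_zeta_series)
  ultimately have "\<exists>f. f holomorphic_on - {1} \<and> (\<forall>s. Re s > 1 \<longrightarrow> f s = (\<Sum>\<^sub>\<infinity>n\<in>{1::nat..}. 1 / of_nat n powr s))"
    by blast
  from someI_ex[OF this, folded zeta_def]
  show "zeta holomorphic_on - {1}" "Re s > 1 \<Longrightarrow> zeta s = (\<Sum>\<^sub>\<infinity>n\<in>{1::nat..}. 1 / of_nat n powr s)"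
    by blast+
qed

text \<open>Level 1 is all that is used from here on: its half-plane contains the interval (0,1) as
  well as a neighbourhood of the pole.\<close>

lemma zeta_eq_scaled_hurwitz:
  assumes "Re s > 0" "s \<noteq> 1"
  shows "(s - 1) * zeta s = scaled_hurwitz 1 s 1"
proof (rule analytic_continuation_open[where f = "\<lambda>s. (s - 1) * zeta s" and g = "\<lambda>s. scaled_hurwitz 1 s 1"])
  show "open {s. Re s > 1}" "open ({s. Re s > 0} - {1})" by (auto intro!: open_delete open_Re_gt)
  have "2 \<in> {s. Re s > 1}" by simp
  thus "{s. Re s > 1} \<noteq> {}" by blast
  show "connected ({s. Re s > 0} - {1})"
    by (intro connected_open_delete open_Re_gt convex_connected convex_halfspace_Re_gt) auto
  show "(\<lambda>s. scaled_hurwitz 1 s 1) holomorphic_on {s. Re s > 0} - {1}"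
    by (rule holomorphic_on_subset[OF holomorphic_scaled_hurwitz]) auto
  show "(\<lambda>s. (s - 1) * zeta s) holomorphic_on {s. Re s > 0} - {1}"
    by (intro holomorphic_intros holomorphic_on_subset[OF zeta_holomorphic]) auto
  show "(z - 1) * zeta z = scaled_hurwitz 1 z 1" if "z \<in> {s. Re s > 1}" for z
    using that scaled_hurwitz_Suc_eq[of 1 0 z] by (simp add: zeta_eq_series scaled_hurwitz_0_eq_zeta_series)
qed (use assms in auto)

text \<open>The residue can be read off the recursion: at s = 1 the integral is multiplied by s - 1
  = 0 and only the boundary term 1^0 = 1 remains.\<close>

lemma tendsto_zeta_pole: "((\<lambda>t. t * zeta (1 + t)) \<longlongrightarrow> 1) (at 0)"
proof -
  have "continuous_on {s. Re s > 0} (\<lambda>s. scaled_hurwitz 1 s 1)"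
    by (intro holomorphic_on_imp_continuous_on holomorphic_on_subset[OF holomorphic_scaled_hurwitz]) auto
  hence "continuous (at 1) (\<lambda>s. scaled_hurwitz 1 s 1)"
    by (simp add: continuous_on_eq_continuous_at open_Re_gt)
  hence "isCont (\<lambda>s. scaled_hurwitz 1 s 1) (1 + 0)" by simp
  hence "isCont (\<lambda>t. scaled_hurwitz 1 (1 + t) 1) 0"
    by (rule isCont_o2[rotated]) (intro continuous_intros)
  moreover have "scaled_hurwitz 1 1 1 = 1" by (simp add: scaled_hurwitz.simps)
  ultimately have lim: "((\<lambda>t. scaled_hurwitz 1 (1 + t) 1) \<longlongrightarrow> 1) (at 0)"
    by (simp add: isCont_def)
  have "eventually (\<lambda>t. scaled_hurwitz 1 (1 + t) 1 = t * zeta (1 + t)) (at 0)"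
  proof -
    have "eventually (\<lambda>t::complex. t \<in> ball 0 1 - {0}) (at 0)"
      by (intro eventually_at_in_open) auto
    thus ?thesis
    proof eventually_elim
      case (elim t)
      hence "\<bar>Re t\<bar> < 1" using abs_Re_le_cmod[of t] by auto
      thus ?case using elim zeta_eq_scaled_hurwitz[of "1 + t"] by auto
    qed
  qed
  from Lim_transform_eventually[OF lim this] show ?thesis .
qed

lemma zeta_euler_maclaurin:
  assumes "Re s > 0" "s \<noteq> 1"
  shows "(\<lambda>n. of_real (real n + 1) powr (- s) -
            (of_real (real n + 1) powr (1 - s) - of_real (real n + 2) powr (1 - s)) / (s - 1))
           sums (zeta s - 1 / (s - 1))"
proof -
  have "scaled_hurwitz 1 s 1 = 1 + (s - 1) * integral {0..1} (\<lambda>v. (1 - of_real v) * scaled_hurwitz 0 (s + 1) (1 + v))"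
    by (simp add: scaled_hurwitz.simps(2))
  hence "zeta s - 1 / (s - 1) = integral {0..1} (\<lambda>v. (1 - of_real v) * scaled_hurwitz 0 (s + 1) (1 + v))"
    using zeta_eq_scaled_hurwitz[OF assms] assms(2) by (simp add: field_simps)
  thus ?thesis
    using has_sum_imp_sums[OF scaled_hurwitz_integral_has_sum[of 1 s]] assms
    by (simp add: add_ac)
qed

subsection \<open>Comparing the inner sum with an integral\<close>

lemma set_integrable_lborel_nonneg:
  fixes f :: "real \<Rightarrow> real"
  assumes "f integrable_on S" "\<And>u. u \<in> S \<Longrightarrow> f u \<ge> 0" "S \<in> sets borel" "f \<in> borel_measurable borel"
  shows "set_integrable lborel S f"
proof -
  have "set_integrable lebesgue S f"
    using nonnegative_absolutely_integrable_1[OF assms(1,2)] .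
  moreover have "(\<lambda>u. indicator S u *\<^sub>R f u) \<in> borel_measurable lborel"
    using assms(3,4) by measurable
  ultimately show ?thesis
    unfolding set_integrable_def by (simp add: integrable_completion)
qed

text \<open>The cells are open on the left and closed on the right so that the ceiling function is
  constant on each of them.\<close>

lemma LINT_halfline_sums:
  fixes g :: "real \<Rightarrow> 'a :: {banach, second_countable_topology}"
  assumes g: "set_integrable lborel {0<..} g"
  shows "(\<lambda>i. LINT u:{real i<..real i + 1}|lborel. g u) sums (LINT u:{0<..}|lborel. g u)"
proof -
  have sub: "set_integrable lborel A g" if "A \<subseteq> {0<..}" "A \<in> sets borel" for A
    using set_integrable_subset[OF g, of A] that by simp
  have part: "(\<Sum>i<N. LINT u:{real i<..real i + 1}|lborel. g u) = (LINT u:{0<..real N}|lborel. g u)" for N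
  proof (induction N)
    case 0
    show ?case by (simp add: set_lebesgue_integral_def)
  next
    case (Suc N)
    have "{0<..real (Suc N)} = {0<..real N} \<union> {real N<..real N + 1}" by auto
    hence "(LINT u:{0<..real (Suc N)}|lborel. g u) =
        (LINT u:{0<..real N}|lborel. g u) + (LINT u:{real N<..real N + 1}|lborel. g u)"
      by (simp only:) (intro set_integral_Un sub, auto)
    thus ?case using Suc by simp
  qed
  have meas: "(\<lambda>u. indicator {0<..} u *\<^sub>R g u) \<in> borel_measurable lborel"
    using g unfolding set_integrable_def by (rule borel_measurable_integrable)
  have "(\<lambda>N. \<integral>u. indicator {0<..real N} u *\<^sub>R g u \<partial>lborel) \<longlonglongrightarrow> (\<integral>u. indicator {0<..} u *\<^sub>R g u \<partial>lborel)"
  proof (rule integral_dominated_convergence[where w = "\<lambda>u. norm (indicator {0<..} u *\<^sub>R g u)"])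
    show "(\<lambda>u. indicator {0<..real N} u *\<^sub>R g u) \<in> borel_measurable lborel" for N
    proof -
      have "set_integrable lborel {0<..real N} g" by (rule sub) auto
      thus ?thesis unfolding set_integrable_def by (rule borel_measurable_integrable)
    qed
    show "integrable lborel (\<lambda>u. norm (indicator {0<..} u *\<^sub>R g u))"
      using g unfolding set_integrable_def by (rule integrable_norm)
    show "AE u in lborel. (\<lambda>N. indicator {0<..real N} u *\<^sub>R g u) \<longlonglongrightarrow> indicator {0<..} u *\<^sub>R g u"
    proof (intro AE_I2 tendsto_eventually)
      fix u :: real
      obtain N0 where "u \<le> real N0" using real_arch_simple by blast
      thus "\<forall>\<^sub>F N in sequentially. indicator {0<..real N} u *\<^sub>R g u = indicator {0<..} u *\<^sub>R g u"
        by (intro eventually_sequentiallyI[of N0]) (auto simp: indicator_def)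
    qed
  qed (use meas in \<open>auto simp: indicator_def\<close>)
  thus ?thesis
    unfolding sums_def part unfolding set_lebesgue_integral_def .
qed

text \<open>Reading \<open>F (real i + 1)\<close> as the integral of
  \<open>F (of_int \<lceil>u\<rceil>)\<close> over a cell of length 1 turns sum minus integral into
  a single integral, which can converge where neither part does.\<close>

lemma LINT_ceiling_diff:
  fixes F :: "real \<Rightarrow> 'a :: {banach, second_countable_topology}"
  assumes F: "set_integrable lborel {real i<..real i + 1} F"
  shows "(LINT u:{real i<..real i + 1}|lborel. F (of_int \<lceil>u\<rceil>) - F u) =
           F (real i + 1) - (LINT u:{real i<..real i + 1}|lborel. F u)"
proof -
  have "(LINT u:{real i<..real i + 1}|lborel. F (of_int \<lceil>u\<rceil>) - F u) =
        (LINT u:{real i<..real i + 1}|lborel. F (real i + 1) - F u)"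
  proof (rule set_lebesgue_integral_cong)
    have "of_int \<lceil>u\<rceil> = real i + 1" if "u \<in> {real i<..real i + 1}" for u
    proof -
      have "\<lceil>u\<rceil> = int i + 1" using that by (intro ceiling_unique) auto
      thus ?thesis by simp
    qed
    thus "\<forall>u. u \<in> {real i<..real i + 1} \<longrightarrow> F (of_int \<lceil>u\<rceil>) - F u = F (real i + 1) - F u" by simp
  qed auto
  also have "\<dots> = (LINT u:{real i<..real i + 1}|lborel. F (real i + 1)) - (LINT u:{real i<..real i + 1}|lborel. F u)"
    by (intro set_integral_diff(2) F) (simp add: set_integrable_def)
  also have "(LINT u:{real i<..real i + 1}|lborel. F (real i + 1)) = F (real i + 1)"
    by (simp add: set_lebesgue_integral_def)
  finally show ?thesis .
qed

lemma LINT_ceiling_diff_sums: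
  fixes F :: "real \<Rightarrow> 'a :: {banach, second_countable_topology}"
  assumes F: "set_integrable lborel {0<..} F" and D: "set_integrable lborel {0<..} (\<lambda>u. F (of_int \<lceil>u\<rceil>) - F u)"
  shows "(\<lambda>i. F (real i + 1)) sums ((LINT u:{0<..}|lborel. F (of_int \<lceil>u\<rceil>) - F u) + (LINT u:{0<..}|lborel. F u))"
proof -
  have "set_integrable lborel {real i<..real i + 1} F" for i
    by (rule set_integrable_subset[OF F]) auto
  hence "(LINT u:{real i<..real i + 1}|lborel. F (of_int \<lceil>u\<rceil>) - F u) + (LINT u:{real i<..real i + 1}|lborel. F u)
      = F (real i + 1)" for i
    by (simp add: LINT_ceiling_diff)
  thus ?thesis
    using sums_add[OF LINT_halfline_sums[OF D] LINT_halfline_sums[OF F]] by simp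
qed

text \<open>The substitution u = c w / (x (1 - w)) maps (0,1) onto the half-line and satisfies c + u
  x = c / (1 - w), so the integrand becomes that of Euler's Beta integral. The change of variables
  yields integrability and value together.\<close>

lemma Beta_integral_halfline:
  fixes a b c x :: real
  assumes a: "a > 0" and b: "b > 0" and c: "c > 0" and x: "x > 0"
  defines "F \<equiv> \<lambda>u. u powr (a - 1) * (c + u * x) powr (- (a + b))"
  shows "set_integrable lborel {0<..} F"
    and "(LINT u:{0<..}|lborel. F u) = c powr (- b) * x powr (- a) * Beta a b"
proof -
  define g where "g w = c * w / (x * (1 - w))" for w :: real
  define g' where "g' w = c / (x * (1 - w)\<^sup>2)" for w :: real
  have inv: "g w = u \<longleftrightarrow> w = u * x / (c + u * x)" if "w \<in> {0<..<1}" "u > 0" for u w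
  proof -
    have "c + u * x > 0" using c x that by (simp add: add_pos_pos)
    thus ?thesis using x that by (auto simp: g_def divide_simps) (auto simp: algebra_simps)
  qed
  have gpos: "g w > 0" if "w \<in> {0<..<1}" for w
    using that c x by (auto simp: g_def)
  have img: "g ` {0<..<1} = {0<..}"
  proof (intro equalityI subsetI)
    fix u :: real assume u: "u \<in> {0<..}"
    have "c + u * x > 0" using c x u by (simp add: add_pos_pos)
    hence "u * x / (c + u * x) \<in> {0<..<1}" using c x u by auto
    moreover from this have "g (u * x / (c + u * x)) = u" using inv u by auto
    ultimately show "u \<in> g ` {0<..<1}" by (metis imageI)
  qed (use gpos in auto)
  have inj: "inj_on g {0<..<1}"
    by (rule inj_onI) (metis gpos inv)
  have der: "(g has_field_derivative g' w) (at w within {0<..<1})" if "w \<in> {0<..<1}" for w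
  proof -
    have "((\<lambda>w. c / x * (inverse (1 - w) - 1)) has_field_derivative g' w) (at w within {0<..<1})"
      unfolding g'_def using that x
      by (auto intro!: derivative_eq_intros simp: power2_eq_square divide_inverse)
    moreover have "c / x * (inverse (1 - w) - 1) = g w" if "w \<in> {0<..<1}" for w
      using that x by (simp add: g_def field_simps)
    ultimately show ?thesis
      using that by (elim has_field_derivative_transform_within[where d = 1]) auto
  qed
  have eq: "\<bar>g' w\<bar> * F (g w) = c powr (- b) * x powr (- a) * (w powr (a - 1) * (1 - w) powr (b - 1))"
    if w: "w \<in> {0<..<1}" for w
  proof -
    have 1: "c + g w * x = c / (1 - w)" using w x by (simp add: g_def field_simps)
    \<comment> \<open>With all powers written as exponentials, the identity of integrands becomes a
      linear identity in the logarithms of c, x, w and 1 - w.\<close>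
    have e: "y powr z = exp (z * ln y)" if "y > 0" for y z :: real
      using that by (simp add: powr_def)
    have 2: "\<bar>g' w\<bar> = exp (ln c - ln x - (ln (1 - w) + ln (1 - w)))"
      using w c x by (simp add: g'_def exp_diff exp_double power2_eq_square)
    have 3: "g w powr (a - 1) = c powr (a - 1) * w powr (a - 1) * x powr (1 - a) * (1 - w) powr (1 - a)"
    proof -
      have L: "ln (g w) = ln c + ln w - ln x - ln (1 - w)"
        using w c x by (simp add: g_def ln_mult ln_div)
      have "g w powr (a - 1) = exp ((a - 1) * (ln c + ln w - ln x - ln (1 - w)))"
        unfolding e[OF gpos[OF w]] L ..
      also have "\<dots> = c powr (a - 1) * w powr (a - 1) * x powr (1 - a) * (1 - w) powr (1 - a)"
        using w c x by (simp add: e exp_add[symmetric] algebra_simps)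
      finally show ?thesis .
    qed
    have 4: "(c / (1 - w)) powr (- (a + b)) = c powr (- (a + b)) * (1 - w) powr (a + b)"
      using w c by (simp add: e exp_add[symmetric] ln_div algebra_simps)
    show ?thesis
      unfolding F_def 1 2 3 4 using w c x
      by (simp add: e exp_add[symmetric] algebra_simps)
  qed
  have B: "((\<lambda>w. \<bar>g' w\<bar> * F (g w)) has_integral c powr (- b) * x powr (- a) * Beta a b) {0<..<1}"
  proof (rule has_integral_eq[rotated])
    show "((\<lambda>w. c powr (- b) * x powr (- a) * (w powr (a - 1) * (1 - w) powr (b - 1))) has_integral
        c powr (- b) * x powr (- a) * Beta a b) {0<..<1}"
      using has_integral_Beta_real[OF a b]
      by (intro has_integral_mult_right) (simp add: has_integral_Icc_iff_Ioo)
  qed (use eq in auto)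
  have "(\<lambda>w. \<bar>g' w\<bar> * F (g w)) absolutely_integrable_on {0<..<1}"
    by (rule nonnegative_absolutely_integrable_1) (use B in \<open>auto simp: F_def\<close>)
  with B have *: "F absolutely_integrable_on {0<..} \<and> integral {0<..} F = c powr (- b) * x powr (- a) * Beta a b"
    using has_absolute_integral_change_of_variables_1'[OF _ der inj, of F] by (auto simp: img integral_unique)
  have "F integrable_on {0<..}" using * by (auto simp: absolutely_integrable_on_def)
  thus int: "set_integrable lborel {0<..} F"
    by (rule set_integrable_lborel_nonneg) (auto simp: F_def)
  show "(LINT u:{0<..}|lborel. F u) = c powr (- b) * x powr (- a) * Beta a b"
    using set_borel_integral_eq_integral(2)[OF int] * by simp
qed


section \<open>Estimates for the difference of inner sum and integral\<close>

definition mt_term :: "real \<Rightarrow> real \<Rightarrow> nat \<Rightarrow> complex \<Rightarrow> real \<Rightarrow> complex" where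
  "mt_term x \<sigma> n t u = of_real u powr (- of_real \<sigma>) * of_real (real n + u * x) powr (- t)"

text \<open>
  \<open>mt_corr\<close> is the difference between the inner sum \<open>\<Sum>\<^sub>m m\<^sup>-\<^sup>\<sigma> (n + m x)\<^sup>-\<^sup>t\<close> and the
  corresponding integral over \<open>(0, \<infinity>)\<close>; unlike these, it converges slightly to the left of \<open>t = 0\<close>.
\<close>

definition mt_corr :: "real \<Rightarrow> real \<Rightarrow> nat \<Rightarrow> complex \<Rightarrow> complex" where
  "mt_corr x \<sigma> n t = (LINT u:{0<..}|lborel. mt_term x \<sigma> n t (of_int \<lceil>u\<rceil>) - mt_term x \<sigma> n t u)"

text \<open>Shape of the majorant in \<open>u\<close>. On (0,1] the terms at 1 and at
  \<open>u\<close> are estimated separately; beyond 1 a mean value estimate gains a factor 1/u. The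
  parameter \<eta> says how far to the left of Re t = 0 the bound is meant to hold.\<close>

definition corr_bound :: "real \<Rightarrow> real \<Rightarrow> real \<Rightarrow> real" where
  "corr_bound \<sigma> \<eta> u = (if u \<le> 1 then 1 + u powr (- \<sigma>) else u powr (\<eta> - \<sigma> - 1))"

text \<open>Near 0 this uses \<sigma> < 1; at infinity it uses \<eta> < \<sigma>, which is what
  leaves room to the left of t = 0.\<close>

lemma corr_bound_integrable:
  assumes "0 < \<sigma>" "\<sigma> < 1" "\<eta> < \<sigma>"
  shows "set_integrable lborel {0<..} (corr_bound \<sigma> \<eta>)"
proof -
  have meas: "corr_bound \<sigma> \<eta> \<in> borel_measurable borel"
    unfolding corr_bound_def by measurable
  have 1: "set_integrable lborel {0..1} (\<lambda>u. 1 + u powr (- \<sigma>))"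
  proof (rule set_integrable_lborel_nonneg)
    have "((\<lambda>u. u powr (- \<sigma>)) has_integral (1 powr (- \<sigma> + 1) / (- \<sigma> + 1))) {0..1}"
      using assms by (intro has_integral_powr_from_0) auto
    hence "(\<lambda>u. u powr (- \<sigma>)) integrable_on {0..1}" by blast
    thus "(\<lambda>u. 1 + u powr (- \<sigma>)) integrable_on {0..1}"
      by (intro integrable_add) auto
  qed auto
  have 2: "set_integrable lborel {1..} (\<lambda>u. u powr (\<eta> - \<sigma> - 1))"
  proof (rule set_integrable_lborel_nonneg)
    show "(\<lambda>u. u powr (\<eta> - \<sigma> - 1)) integrable_on {1..}"
      using has_integral_powr_to_inf[of "\<eta> - \<sigma> - 1" 1] assms by auto
  qed auto
  have "set_integrable lborel {0<..1} (\<lambda>u. 1 + u powr (- \<sigma>))"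
    by (rule set_integrable_subset[OF 1]) auto
  also have "?this \<longleftrightarrow> set_integrable lborel {0<..1} (corr_bound \<sigma> \<eta>)"
    by (intro set_integrable_cong) (auto simp: corr_bound_def)
  finally have 3: "set_integrable lborel {0<..1} (corr_bound \<sigma> \<eta>)" .
  have "set_integrable lborel {1<..} (\<lambda>u. u powr (\<eta> - \<sigma> - 1))"
    by (rule set_integrable_subset[OF 2]) auto
  also have "?this \<longleftrightarrow> set_integrable lborel {1<..} (corr_bound \<sigma> \<eta>)"
    by (intro set_integrable_cong) (auto simp: corr_bound_def)
  finally have "set_integrable lborel {1<..} (corr_bound \<sigma> \<eta>)" .
  with 3 have "set_integrable lborel ({0<..1} \<union> {1<..}) (corr_bound \<sigma> \<eta>)"
    by (rule set_integrable_Un) auto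
  also have "{0<..1} \<union> {1<..} = {0::real<..}" by auto
  finally show ?thesis .
qed

text \<open>For u > 1 this is the mean value inequality on the segment from \<open>u\<close> to its
  ceiling: the derivative is smaller than the function by a factor 1/u. The only price in
  \<open>n\<close> is n^\<eta>, mild enough to be absorbed later by the weight n^(\<sigma> - 2). The
  constant \<sigma> + R stems from the two terms of the derivative; the extra 1 makes it at least 1,
  as needed for u \<le> 1.\<close>

lemma mt_term_diff_bound:
  assumes n: "n \<ge> 1" and u: "u > 0" and x: "x > 0" and \<sigma>: "0 < \<sigma>" and \<eta>: "0 \<le> \<eta>" "\<eta> < \<sigma>"
    and t: "Re t \<ge> - \<eta>" "norm t \<le> R"
  shows "norm (mt_term x \<sigma> n t (of_int \<lceil>u\<rceil>) - mt_term x \<sigma> n t u)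
           \<le> (\<sigma> + R + 1) * (1 + x) powr \<eta> * real n powr \<eta> * corr_bound \<sigma> \<eta> u"
proof -
  have R: "R \<ge> 0" using t(2) norm_ge_zero order_trans by blast
  \<comment> \<open>The base is at least 1, so the exponent -Re t may be raised to \<eta>; then n +
    w x \<le> (1 + x) n max(1, w) separates the variables.\<close>
  have pow: "norm (complex_of_real (real n + w * x) powr (- t)) \<le> (1 + x) powr \<eta> * real n powr \<eta> * max 1 w powr \<eta>"
    if w: "w > 0" for w
  proof -
    have pos: "real n + w * x \<ge> 1" using n w x by (simp add: add_increasing2)
    hence "norm (complex_of_real (real n + w * x) powr (- t)) = (real n + w * x) powr (- Re t)"
      by (subst norm_of_real_powr) auto
    also have "\<dots> \<le> (real n + w * x) powr \<eta>" using t pos by (intro powr_mono) auto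
    also have "real n + w * x \<le> real n * max 1 w + (real n * max 1 w) * x"
    proof (intro add_mono mult_right_mono)
      show "real n \<le> real n * max 1 w" using n by simp
      have "1 * w \<le> real n * max 1 w" using n w by (intro mult_mono) auto
      thus "w \<le> real n * max 1 w" by simp
    qed (use x in auto)
    hence "(real n + w * x) powr \<eta> \<le> ((1 + x) * real n * max 1 w) powr \<eta>"
      using pos \<eta> by (intro powr_mono2) (auto simp: algebra_simps)
    also have "\<dots> = (1 + x) powr \<eta> * real n powr \<eta> * max 1 w powr \<eta>"
      using x n w by (simp add: powr_mult)
    finally show ?thesis .
  qed
  show ?thesis
  proof (cases "u \<le> 1")
    case True
    hence c: "\<lceil>u\<rceil> = 1" using u by (intro ceiling_unique) auto
    have "norm (mt_term x \<sigma> n t 1) \<le> (1 + x) powr \<eta> * real n powr \<eta>"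
      using pow[of 1] by (simp add: mt_term_def norm_mult)
    moreover have "norm (mt_term x \<sigma> n t u) \<le> u powr (- \<sigma>) * ((1 + x) powr \<eta> * real n powr \<eta>)"
      using pow[of u] True u by (auto simp: mt_term_def norm_mult norm_of_real_powr intro!: mult_left_mono)
    ultimately have "norm (mt_term x \<sigma> n t 1 - mt_term x \<sigma> n t u)
        \<le> 1 * ((1 + x) powr \<eta> * real n powr \<eta> * (1 + u powr (- \<sigma>)))"
      by (intro order_trans[OF norm_triangle_ineq4]) (simp add: algebra_simps)
    also have "\<dots> \<le> (\<sigma> + R + 1) * ((1 + x) powr \<eta> * real n powr \<eta> * (1 + u powr (- \<sigma>)))"
      using \<sigma> R by (intro mult_right_mono) auto
    finally show ?thesis using True by (simp add: c corr_bound_def mult_ac)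
  next
    case False
    \<comment> \<open>The extension of \<open>mt_term\<close> to complex \<open>V\<close>, so that
      the complex mean value inequality applies on the image of a real segment.\<close>
    define G where "G V = V powr (- of_real \<sigma>) * (of_real (real n) + V * of_real x) powr (- t)" for V :: complex
    define G' where "G' V = - of_real \<sigma> * (V powr (- of_real \<sigma> - 1) * (of_real (real n) + V * of_real x) powr (- t))
        - t * of_real x * (V powr (- of_real \<sigma>) * (of_real (real n) + V * of_real x) powr (- t - 1))" for V :: complex
    let ?C = "(1 + x) powr \<eta> * real n powr \<eta>"
    define S where "S = complex_of_real ` {u..of_int \<lceil>u\<rceil>}"
    have "norm (G (of_int \<lceil>u\<rceil>) - G (of_real u)) \<le> ((\<sigma> + R) * ?C * u powr (\<eta> - \<sigma> - 1)) * norm (of_int \<lceil>u\<rceil> - complex_of_real u)"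
    proof (rule field_differentiable_bound[where S = S and f' = G'])
      show "convex S" unfolding S_def
        by (intro convex_linear_image convex_real_interval bounded_linear.linear bounded_linear_of_real)
      have "of_real (of_int \<lceil>u\<rceil>) \<in> S" unfolding S_def by (rule imageI) auto
      thus "of_int \<lceil>u\<rceil> \<in> S" "of_real u \<in> S" unfolding S_def by auto
    next
      fix V assume "V \<in> S"
      then obtain w where w: "V = of_real w" "w \<ge> u" by (auto simp: S_def)
      have w1: "w > 1" using w False by simp
      have npos: "real n + w * x > 0" using n w1 x by (simp add: add_pos_pos)
      have eqV: "of_real (real n) + V * of_real x = complex_of_real (real n + w * x)" by (simp add: w)
      have "V \<notin> \<real>\<^sub>\<le>\<^sub>0" using w1 by (simp add: w)
      moreover have "complex_of_real (real n) + V * of_real x \<notin> \<real>\<^sub>\<le>\<^sub>0"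
        unfolding eqV using npos by (subst nonpos_Reals_of_real_iff) simp
      ultimately show "(G has_field_derivative G' V) (at V within S)"
        unfolding G_def G'_def by (auto intro!: derivative_eq_intros simp: algebra_simps)
      let ?N = "norm (complex_of_real (real n + w * x) powr (- t))"
      have "norm (complex_of_real (real n + w * x) powr (- t - 1)) = ?N / (real n + w * x)"
        using npos by (simp only: norm_of_real_powr) (simp add: powr_diff)
      \<comment> \<open>Dropping \<open>n\<close> from the denominator lets the inner derivative
        \<open>x\<close> cancel, so this term has the same size as the one from differentiating
        V^(-\<sigma>).\<close>
      also have "\<dots> \<le> ?N / (w * x)"
        using w1 x n by (intro divide_left_mono mult_pos_pos) (auto intro!: add_pos_pos)
      finally have 2: "norm (complex_of_real (real n + w * x) powr (- t - 1)) \<le> ?N / (w * x)" .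
      have "norm (G' V) \<le> \<sigma> * (w powr (- \<sigma> - 1) * ?N) + norm t * x * (w powr (- \<sigma>) * (?N / (w * x)))"
        unfolding G'_def eqV
      proof (rule order_trans[OF norm_triangle_ineq4], rule add_mono)
        show "norm (- of_real \<sigma> * (V powr (- of_real \<sigma> - 1) * complex_of_real (real n + w * x) powr (- t)))
            \<le> \<sigma> * (w powr (- \<sigma> - 1) * ?N)"
          using \<sigma> w1 unfolding norm_mult w(1) by (subst norm_of_real_powr) auto
        have "norm (t * of_real x * (V powr (- of_real \<sigma>) * complex_of_real (real n + w * x) powr (- t - 1)))
            = norm t * x * (w powr (- \<sigma>) * norm (complex_of_real (real n + w * x) powr (- t - 1)))"
          using x w1 unfolding norm_mult w(1) by (subst norm_of_real_powr) auto
        also have "\<dots> \<le> norm t * x * (w powr (- \<sigma>) * (?N / (w * x)))"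
          using 2 x by (intro mult_left_mono) auto
        finally show "norm (t * of_real x * (V powr (- of_real \<sigma>) * complex_of_real (real n + w * x) powr (- t - 1)))
            \<le> norm t * x * (w powr (- \<sigma>) * (?N / (w * x)))" .
      qed
      also have "norm t * x * (w powr (- \<sigma>) * (?N / (w * x))) = norm t * (w powr (- \<sigma> - 1) * ?N)"
        using x w1 by (simp add: powr_diff)
      also have "\<sigma> * (w powr (- \<sigma> - 1) * ?N) + norm t * (w powr (- \<sigma> - 1) * ?N) = (\<sigma> + norm t) * (w powr (- \<sigma> - 1) * ?N)"
        by (simp add: algebra_simps)
      also have "\<dots> \<le> (\<sigma> + R) * (w powr (- \<sigma> - 1) * (?C * w powr \<eta>))"
        using t \<sigma> pow[of w] w1 R by (intro mult_mono mult_nonneg_nonneg) (auto simp: max_def)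
      also have "\<dots> = (\<sigma> + R) * ?C * w powr (\<eta> - \<sigma> - 1)"
        using powr_add[of w "- \<sigma> - 1" \<eta>] by (simp add: algebra_simps)
      also have "\<dots> \<le> (\<sigma> + R) * ?C * u powr (\<eta> - \<sigma> - 1)"
        using u w(2) \<eta> \<sigma> R by (intro mult_left_mono powr_mono2') auto
      finally show "norm (G' V) \<le> (\<sigma> + R) * ?C * u powr (\<eta> - \<sigma> - 1)" .
    qed
    also have "norm (of_int \<lceil>u\<rceil> - complex_of_real u) \<le> 1"
    proof -
      have "norm (of_int \<lceil>u\<rceil> - complex_of_real u) = \<bar>of_int \<lceil>u\<rceil> - u\<bar>"
        by (metis norm_of_real of_real_diff of_real_of_int_eq)
      thus ?thesis by linarith
    qed
    also have "(\<sigma> + R) * ?C * u powr (\<eta> - \<sigma> - 1) * 1 \<le> (\<sigma> + R + 1) * ?C * u powr (\<eta> - \<sigma> - 1)"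
      unfolding mult_1_right using \<sigma> R by (intro mult_right_mono) auto
    finally have "norm (G (of_int \<lceil>u\<rceil>) - G (of_real u)) \<le> (\<sigma> + R + 1) * ?C * u powr (\<eta> - \<sigma> - 1)"
      using \<sigma> R by (simp add: mult_left_mono)
    thus ?thesis using False by (simp add: G_def mt_term_def corr_bound_def mult_ac)
  qed
qed

lemma mt_term_measurable [measurable]: "mt_term x \<sigma> n t \<in> borel_measurable borel"
  unfolding mt_term_def powr_def by measurable

lemma mt_term_diff_integrable:
  assumes "n \<ge> 1" "x > 0" "0 < \<sigma>" "\<sigma> < 1" "0 \<le> \<eta>" "\<eta> < \<sigma>" "Re t \<ge> - \<eta>"
  shows "set_integrable lborel {0<..} (\<lambda>u. mt_term x \<sigma> n t (of_int \<lceil>u\<rceil>) - mt_term x \<sigma> n t u)"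
  unfolding set_integrable_def
proof (rule Bochner_Integration.integrable_bound)
  let ?C = "(\<sigma> + norm t + 1) * (1 + x) powr \<eta> * real n powr \<eta>"
  have "set_integrable lborel {0<..} (\<lambda>u. ?C * corr_bound \<sigma> \<eta> u)"
    using corr_bound_integrable[of \<sigma> \<eta>] assms by simp
  thus "integrable lborel (\<lambda>u. indicator {0<..} u *\<^sub>R (?C * corr_bound \<sigma> \<eta> u))"
    by (simp add: set_integrable_def)
  show "AE u in lborel. norm (indicator {0<..} u *\<^sub>R (mt_term x \<sigma> n t (of_int \<lceil>u\<rceil>) - mt_term x \<sigma> n t u))
      \<le> norm (indicator {0<..} u *\<^sub>R (?C * corr_bound \<sigma> \<eta> u))"
    using mt_term_diff_bound[of n _ x \<sigma> \<eta> t "norm t"] assms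
    by (intro AE_I2) (auto simp: indicator_def intro: order_trans[OF _ abs_ge_self])
qed measurable

lemma norm_mt_corr_le:
  assumes "n \<ge> 1" "x > 0" "0 < \<sigma>" "\<sigma> < 1" "0 \<le> \<eta>" "\<eta> < \<sigma>" "Re t \<ge> - \<eta>" "norm t \<le> R"
  shows "norm (mt_corr x \<sigma> n t)
          \<le> (\<sigma> + R + 1) * (1 + x) powr \<eta> * real n powr \<eta> * (LINT u:{0<..}|lborel. corr_bound \<sigma> \<eta> u)"
proof -
  let ?C = "(\<sigma> + R + 1) * (1 + x) powr \<eta> * real n powr \<eta>"
  have int: "set_integrable lborel {0<..} (\<lambda>u. ?C * corr_bound \<sigma> \<eta> u)"
    using corr_bound_integrable[of \<sigma> \<eta>] assms by simp
  have "norm (mt_corr x \<sigma> n t) \<le> (LINT u:{0<..}|lborel. ?C * corr_bound \<sigma> \<eta> u)"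
    unfolding mt_corr_def set_lebesgue_integral_def
  proof (rule Bochner_Integration.integral_norm_bound_integral)
    show "integrable lborel (\<lambda>u. indicator {0<..} u *\<^sub>R (mt_term x \<sigma> n t (of_int \<lceil>u\<rceil>) - mt_term x \<sigma> n t u))"
      using mt_term_diff_integrable[of n x \<sigma> \<eta> t] assms by (simp add: set_integrable_def)
    show "integrable lborel (\<lambda>u. indicator {0<..} u *\<^sub>R (?C * corr_bound \<sigma> \<eta> u))"
      using int by (simp add: set_integrable_def)
  qed (use mt_term_diff_bound[of n _ x \<sigma> \<eta> t R] assms in \<open>auto simp: indicator_def\<close>)
  thus ?thesis by simp
qed

lemma holomorphic_mt_corr:
  assumes "n \<ge> 1" "x > 0" "0 < \<sigma>" "\<sigma> < 1" "0 \<le> \<eta>" "\<eta> < \<sigma>"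
  shows "mt_corr x \<sigma> n holomorphic_on {t. Re t > - \<eta>}"
  unfolding mt_corr_def[abs_def] set_lebesgue_integral_def
proof (rule holomorphic_on_integral_dominated[OF open_Re_gt])
  fix u :: real
  have nz: "real n + w * x > 0" if "w > 0" for w using that assms by (simp add: add_pos_pos)
  have "(\<lambda>t. mt_term x \<sigma> n t w) holomorphic_on {t. Re t > - \<eta>}" if "w > 0" for w
    unfolding mt_term_def using nz[OF that]
    by (intro holomorphic_intros, subst nonpos_Reals_of_real_iff) auto
  thus "(\<lambda>t. indicator {0<..} u *\<^sub>R (mt_term x \<sigma> n t (of_int \<lceil>u\<rceil>) - mt_term x \<sigma> n t u))
      holomorphic_on {t. Re t > - \<eta>}"
    by (cases "u > 0") (auto intro!: holomorphic_intros)
  fix t0 assume t0: "t0 \<in> {t. Re t > - \<eta>}"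
  \<comment> \<open>On this ball Re t stays at least -\<eta> and |t| at most |t0| + 1, so one
    constant R = |t0| + 1 serves all of it.\<close>
  define d where "d = min 1 (Re t0 + \<eta>)"
  let ?C = "(\<sigma> + (norm t0 + 1) + 1) * (1 + x) powr \<eta> * real n powr \<eta>"
  have "norm (indicator {0<..} u *\<^sub>R (mt_term x \<sigma> n t (of_int \<lceil>u\<rceil>) - mt_term x \<sigma> n t u))
      \<le> indicator {0<..} u *\<^sub>R (?C * corr_bound \<sigma> \<eta> u)" if t: "t \<in> ball t0 d" for t u
  proof -
    have "norm (t0 - t) < d" using t by (simp add: dist_norm)
    moreover have "\<bar>Re t0 - Re t\<bar> \<le> norm (t0 - t)" using abs_Re_le_cmod[of "t0 - t"] by simp
    moreover have "norm t \<le> norm t0 + norm (t0 - t)" by (metis norm_minus_commute norm_triangle_sub)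
    ultimately have "- \<eta> \<le> Re t" "norm t \<le> norm t0 + 1" by (auto simp: d_def)
    thus ?thesis using mt_term_diff_bound[of n u x \<sigma> \<eta> t "norm t0 + 1"] assms
      by (auto simp: indicator_def)
  qed
  moreover have "integrable lborel (\<lambda>u. indicator {0<..} u *\<^sub>R (?C * corr_bound \<sigma> \<eta> u))"
    using corr_bound_integrable[of \<sigma> \<eta>] assms
    unfolding set_integrable_def[symmetric] by simp
  moreover have "d > 0" using t0 by (simp add: d_def)
  ultimately show "\<exists>d>0. \<exists>g. integrable lborel g \<and> (\<forall>t\<in>ball t0 d. \<forall>u\<in>space lborel.
      norm (indicator {0<..} u *\<^sub>R (mt_term x \<sigma> n t (of_int \<lceil>u\<rceil>) - mt_term x \<sigma> n t u)) \<le> g u)"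
    by blast
qed measurable

subsection \<open>The case of r + s = 2 with real s between 0 and 1\<close>

text \<open>As a < 1, the factor (1 + 1/i)^a is at most 1 + 1/i, so the increment is at most i^(a -
  1).\<close>

lemma powr_Suc_diff_tendsto_0:
  fixes a :: real
  assumes "0 < a" "a < 1"
  shows "(\<lambda>i. (real i + 1) powr a - real i powr a) \<longlonglongrightarrow> 0"
proof (rule tendsto_sandwich[where f = "\<lambda>_. 0" and h = "\<lambda>i. real i powr (a - 1)"])
  show "(\<lambda>i. real i powr (a - 1)) \<longlonglongrightarrow> 0"
    using assms by (intro tendsto_neg_powr filterlim_real_sequentially) auto
  show "\<forall>\<^sub>F i in sequentially. (real i + 1) powr a - real i powr a \<le> real i powr (a - 1)"
    using eventually_gt_at_top[of 0]
  proof eventually_elim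
    case (elim i)
    have "(real i + 1) powr a = real i powr a * (1 + 1 / real i) powr a"
    proof -
      have "real i + 1 = real i * (1 + 1 / real i)" using elim by (simp add: field_simps)
      thus ?thesis using powr_mult[of "real i" "1 + 1 / real i" a] by simp
    qed
    also have "\<dots> \<le> real i powr a * (1 + 1 / real i) powr 1"
      using assms by (intro mult_left_mono powr_mono) auto
    also have "\<dots> = real i powr a + real i powr (a - 1)"
      using elim by (simp add: powr_diff field_simps)
    finally show ?case by simp
  qed
  show "\<forall>\<^sub>F i in sequentially. 0 \<le> (real i + 1) powr a - real i powr a"
    using assms by (intro always_eventually) (auto intro: powr_mono2)
qed auto

text \<open>Obtained by subtracting the integral over [0, i] from that over [0, i + 1]; in this way
  the cell at i = 0, where the integrand is unbounded, needs no separate treatment.\<close>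

lemma LINT_powr_unit_interval:
  assumes "0 < \<sigma>" "\<sigma> < 1"
  shows "set_integrable lborel {real i<..real i + 1} (\<lambda>u. u powr (- \<sigma>))"
    and "(LINT u:{real i<..real i + 1}|lborel. u powr (- \<sigma>)) =
           ((real i + 1) powr (1 - \<sigma>) - real i powr (1 - \<sigma>)) / (1 - \<sigma>)"
proof -
  have I: "((\<lambda>u. u powr (- \<sigma>)) has_integral c powr (1 - \<sigma>) / (1 - \<sigma>)) {0..c}" if "c \<ge> 0" for c
    using has_integral_powr_from_0[of "- \<sigma>" c] that assms by simp
  have int: "set_integrable lborel {0..c} (\<lambda>u. u powr (- \<sigma>))" if "c \<ge> 0" for c
    using I[OF that] by (intro set_integrable_lborel_nonneg) auto
  have val: "(LINT u:{0..c}|lborel. u powr (- \<sigma>)) = c powr (1 - \<sigma>) / (1 - \<sigma>)" if "c \<ge> 0" for c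
    using set_borel_integral_eq_integral(2)[OF int[OF that]] I[OF that] by (simp add: integral_unique)
  show int1: "set_integrable lborel {real i<..real i + 1} (\<lambda>u. u powr (- \<sigma>))"
    by (rule set_integrable_subset[OF int[of "real i + 1"]]) auto
  have "{0..real i + 1} = {0..real i} \<union> {real i<..real i + 1}" by auto
  hence "(LINT u:{0..real i + 1}|lborel. u powr (- \<sigma>)) =
      (LINT u:{0..real i}|lborel. u powr (- \<sigma>)) + (LINT u:{real i<..real i + 1}|lborel. u powr (- \<sigma>))"
    by (simp only:) (intro set_integral_Un int int1, auto)
  thus "(LINT u:{real i<..real i + 1}|lborel. u powr (- \<sigma>)) =
           ((real i + 1) powr (1 - \<sigma>) - real i powr (1 - \<sigma>)) / (1 - \<sigma>)"
    by (simp add: val diff_divide_distrib)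
qed

lemma mt_term_of_real:
  assumes "u > 0" "x > 0"
  shows "mt_term x \<sigma> n (of_real \<tau>) u = of_real (u powr (- \<sigma>) * (real n + u * x) powr (- \<tau>))"
proof -
  have "real n + u * x \<ge> 0" using assms by (simp add: add_nonneg_nonneg)
  thus ?thesis
    using assms powr_of_real[of u "- \<sigma>"] powr_of_real[of "real n + u * x" "- \<tau>"]
    by (simp add: mt_term_def del: of_real_add)
qed

lemma set_integrable_complex_of_real:
  assumes "set_integrable M S f"
  shows "set_integrable M S (\<lambda>u. complex_of_real (f u))"
proof -
  have "(\<lambda>u. indicator S u *\<^sub>R complex_of_real (f u)) = (\<lambda>u. complex_of_real (indicator S u *\<^sub>R f u))"
    by (simp add: scaleR_conv_of_real)
  moreover have "integrable M (\<lambda>u. complex_of_real (indicator S u *\<^sub>R f u))"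
    using assms unfolding set_integrable_def by (rule integrable_of_real)
  ultimately show ?thesis unfolding set_integrable_def by (simp only:)
qed

text \<open>At t = 0 the second factor of \<open>mt_term\<close> is 1, so neither \<open>n\<close>
  nor \<open>x\<close> matters, and the cells give (i + 1)^(-\<sigma>) minus the integral of
  u^(-\<sigma>) over (i, i + 1]. Euler-Maclaurin for \<open>zeta\<close> subtracts the integral over
  the next cell instead. The two series therefore differ by a telescoping one, whose sum 1 /
  (\<sigma> - 1) is the polar term occurring there.\<close>

lemma mt_corr_0:
  assumes "n \<ge> 1" "x > 0" "0 < \<sigma>" "\<sigma> < 1"
  shows "mt_corr x \<sigma> n 0 = zeta (of_real \<sigma>)"
proof -
  \<comment> \<open>Up to the factor 1 / (1 - \<sigma>) this is the integral of u^(-\<sigma>) over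
    the cell (i, i + 1]; it tends to 0 although the integrals do not sum up.\<close>
  define D where "D i = complex_of_real ((real i + 1) powr (1 - \<sigma>) - real i powr (1 - \<sigma>))" for i
  have F: "mt_term x \<sigma> n 0 u = of_real (u powr (- \<sigma>))" if "u > 0" for u
  proof -
    have "real n + u * x > 0" using assms that by (simp add: add_pos_pos)
    thus ?thesis using mt_term_of_real[of u x \<sigma> n 0] that assms by simp
  qed
  have "(LINT u:{real i<..real i + 1}|lborel. mt_term x \<sigma> n 0 (of_int \<lceil>u\<rceil>) - mt_term x \<sigma> n 0 u)
        = of_real ((real i + 1) powr (- \<sigma>)) - D i / of_real (1 - \<sigma>)" for i
  proof -
    have eq: "mt_term x \<sigma> n 0 u = of_real (u powr (- \<sigma>))" if "u \<in> {real i<..real i + 1}" for u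
      using that by (intro F) auto
    have "set_integrable lborel {real i<..real i + 1} (mt_term x \<sigma> n 0)
        \<longleftrightarrow> set_integrable lborel {real i<..real i + 1} (\<lambda>u. complex_of_real (u powr (- \<sigma>)))"
      by (intro set_integrable_cong eq) auto
    also have "\<dots>"
      using LINT_powr_unit_interval(1)[OF assms(3,4)] by (simp add: set_integrable_complex_of_real)
    finally have "(LINT u:{real i<..real i + 1}|lborel. mt_term x \<sigma> n 0 (of_int \<lceil>u\<rceil>) - mt_term x \<sigma> n 0 u)
        = mt_term x \<sigma> n 0 (real i + 1) - (LINT u:{real i<..real i + 1}|lborel. mt_term x \<sigma> n 0 u)"
      by (rule LINT_ceiling_diff)
    also have "(LINT u:{real i<..real i + 1}|lborel. mt_term x \<sigma> n 0 u) =
        (LINT u:{real i<..real i + 1}|lborel. complex_of_real (u powr (- \<sigma>)))"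
      by (intro set_lebesgue_integral_cong) (auto intro!: F)
    also have "\<dots> = D i / of_real (1 - \<sigma>)"
      by (simp only: set_integral_complex_of_real LINT_powr_unit_interval(2)[OF assms(3,4)] D_def of_real_divide)
    also have "mt_term x \<sigma> n 0 (real i + 1) = of_real ((real i + 1) powr (- \<sigma>))"
      by (intro F) auto
    finally show ?thesis .
  qed
  moreover have "set_integrable lborel {0<..} (\<lambda>u. mt_term x \<sigma> n 0 (of_int \<lceil>u\<rceil>) - mt_term x \<sigma> n 0 u)"
    using assms by (intro mt_term_diff_integrable[where \<eta> = 0]) auto
  ultimately have A: "(\<lambda>i. of_real ((real i + 1) powr (- \<sigma>)) - D i / of_real (1 - \<sigma>)) sums mt_corr x \<sigma> n 0"
    unfolding mt_corr_def using LINT_halfline_sums by (metis (no_types, lifting) sums_cong)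
  have "of_real \<sigma> \<noteq> (1 :: complex)" using assms by (metis of_real_eq_1_iff less_irrefl)
  hence Z: "(\<lambda>i. of_real ((real i + 1) powr (- \<sigma>)) - D (Suc i) / of_real (1 - \<sigma>)) sums
          (zeta (of_real \<sigma>) - 1 / (of_real \<sigma> - 1))"
  proof -
    have "of_real (real i + 1) powr (- of_real \<sigma>) -
            (of_real (real i + 1) powr (1 - of_real \<sigma>) - of_real (real i + 2) powr (1 - of_real \<sigma>)) / (of_real \<sigma> - 1)
         = complex_of_real ((real i + 1) powr (- \<sigma>)) - D (Suc i) / of_real (1 - \<sigma>)" for i
    proof -
      have p: "complex_of_real (real i + 1) powr (- of_real \<sigma>) = of_real ((real i + 1) powr (- \<sigma>))"
        "complex_of_real (real i + 1) powr (1 - of_real \<sigma>) = of_real ((real i + 1) powr (1 - \<sigma>))"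
        "complex_of_real (real i + 2) powr (1 - of_real \<sigma>) = of_real ((real i + 2) powr (1 - \<sigma>))"
        using powr_of_real[of "real i + 1" "- \<sigma>"] powr_of_real[of "real i + 1" "1 - \<sigma>"]
          powr_of_real[of "real i + 2" "1 - \<sigma>"] by (simp_all del: of_real_add)
      have d: "complex_of_real \<sigma> - 1 = - of_real (1 - \<sigma>)" by simp
      have "D (Suc i) = of_real ((real i + 2) powr (1 - \<sigma>)) - of_real ((real i + 1) powr (1 - \<sigma>))"
        by (simp add: D_def add_ac)
      thus ?thesis unfolding p d by (simp del: of_real_diff add: diff_divide_distrib)
    qed
    with zeta_euler_maclaurin[of "of_real \<sigma>"] \<open>of_real \<sigma> \<noteq> (1 :: complex)\<close> assms show ?thesis by simp
  qed
  have "D \<longlonglongrightarrow> 0"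
  proof -
    have "(\<lambda>i. (real i + 1) powr (1 - \<sigma>) - real i powr (1 - \<sigma>)) \<longlonglongrightarrow> 0"
      using assms by (intro powr_Suc_diff_tendsto_0) auto
    from tendsto_of_real[OF this, where 'a = complex]
    show ?thesis unfolding D_def[abs_def] of_real_0 .
  qed
  from sums_divide[OF telescope_sums[OF this]]
  have "(\<lambda>i. (D (Suc i) - D i) / of_real (1 - \<sigma>)) sums ((0 - D 0) / of_real (1 - \<sigma>))" .
  hence "(\<lambda>i. (of_real ((real i + 1) powr (- \<sigma>)) - D i / of_real (1 - \<sigma>)) -
      (of_real ((real i + 1) powr (- \<sigma>)) - D (Suc i) / of_real (1 - \<sigma>))) sums ((0 - D 0) / of_real (1 - \<sigma>))"
    by (simp add: diff_divide_distrib)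
  from sums_unique2[OF this sums_diff[OF A Z]]
  have "(0 - D 0) / of_real (1 - \<sigma>) = mt_corr x \<sigma> n 0 - (zeta (of_real \<sigma>) - 1 / (of_real \<sigma> - 1))" .
  \<comment> \<open>Here \<open>D 0\<close> is 1, because \<open>0 powr (1 - \<sigma>)\<close> is
    0.\<close>
  moreover have "(0 - D 0) / of_real (1 - \<sigma>) = 1 / (of_real \<sigma> - 1)"
    using assms by (simp add: D_def minus_divide_right)
  ultimately show ?thesis by simp
qed

text \<open>Real \<tau> > 1 is all that the later identity theorem in t starts from. The Beta
  integral is taken with a = 1 - \<sigma> and b = \<sigma> + \<tau> - 1, so that a + b =
  \<tau>.\<close>

lemma inner_sum_eq:
  assumes n: "n \<ge> 1" and x: "x > 0" and \<sigma>: "0 < \<sigma>" "\<sigma> < 1" and \<tau>: "\<tau> > 1"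
  shows "(\<Sum>\<^sub>\<infinity>m\<in>{1::nat..}. mt_term x \<sigma> n (of_real \<tau>) (real m)) =
     mt_corr x \<sigma> n (of_real \<tau>) + of_real (real n powr (1 - \<sigma> - \<tau>) * x powr (\<sigma> - 1) * Beta (1 - \<sigma>) (\<sigma> + \<tau> - 1))"
proof -
  define fr where "fr u = u powr (- \<sigma>) * (real n + u * x) powr (- \<tau>)" for u
  let ?F = "mt_term x \<sigma> n (of_real \<tau>)"
  let ?B = "real n powr (1 - \<sigma> - \<tau>) * x powr (\<sigma> - 1) * Beta (1 - \<sigma>) (\<sigma> + \<tau> - 1)"
  have F: "?F u = of_real (fr u)" if "u > 0" for u
    using mt_term_of_real[OF that x] by (simp add: fr_def)
  have fr: "set_integrable lborel {0<..} fr" "(LINT u:{0<..}|lborel. fr u) = ?B"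
    using Beta_integral_halfline[of "1 - \<sigma>" "\<sigma> + \<tau> - 1" "real n" x] n x \<sigma> \<tau>
    by (simp_all add: fr_def[abs_def] diff_diff_eq)
  have "set_integrable lborel {0<..} ?F \<longleftrightarrow> set_integrable lborel {0<..} (\<lambda>u. complex_of_real (fr u))"
    by (intro set_integrable_cong F) auto
  hence int: "set_integrable lborel {0<..} ?F"
    using fr(1) by (simp add: set_integrable_complex_of_real)
  have val: "(LINT u:{0<..}|lborel. ?F u) = of_real ?B"
  proof -
    have "(LINT u:{0<..}|lborel. ?F u) = (LINT u:{0<..}|lborel. complex_of_real (fr u))"
      by (intro set_lebesgue_integral_cong) (auto intro!: F)
    thus ?thesis by (simp only: set_integral_complex_of_real fr(2))
  qed
  have "set_integrable lborel {0<..} (\<lambda>u. ?F (of_int \<lceil>u\<rceil>) - ?F u)"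
    using assms by (intro mt_term_diff_integrable[where \<eta> = 0]) auto
  from LINT_ceiling_diff_sums[OF int this]
  have s: "(\<lambda>i. ?F (real i + 1)) sums (mt_corr x \<sigma> n (of_real \<tau>) + of_real ?B)"
    by (simp only: val mt_corr_def)
  \<comment> \<open>For real exponents the terms are nonnegative, so ordinary convergence is already
    absolute; this is what allows passing from \<open>sums\<close> to the unordered sum.\<close>
  have "summable (\<lambda>i. norm (?F (real i + 1)))"
  proof -
    have "summable (\<lambda>i. complex_of_real (fr (real i + 1)))"
      using sums_summable[OF s] by (subst (asm) F) auto
    hence "summable (\<lambda>i. fr (real i + 1))" by (simp add: summable_complex_of_real)
    moreover have "norm (?F (real i + 1)) = fr (real i + 1)" for i
    proof -
      have "?F (real i + 1) = of_real (fr (real i + 1))" by (intro F) auto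
      moreover have "fr (real i + 1) \<ge> 0" by (simp add: fr_def)
      ultimately show ?thesis by (simp only: norm_of_real abs_of_nonneg)
    qed
    ultimately show ?thesis by simp
  qed
  from norm_summable_imp_has_sum[OF this s]
  have "((\<lambda>i. ?F (real (Suc i))) has_sum (mt_corr x \<sigma> n (of_real \<tau>) + of_real ?B)) UNIV"
    by (simp add: add_ac)
  also have "?this \<longleftrightarrow> ((\<lambda>m. ?F (real m)) has_sum (mt_corr x \<sigma> n (of_real \<tau>) + of_real ?B)) {1..}"
    by (rule has_sum_reindex_bij_betw[of Suc])
       (auto simp: bij_betw_def image_iff Suc_le_eq gr0_conv_Suc)
  finally show ?thesis by (rule infsumI)
qed

section \<open>Summation of the corrections over n, with weight n^(-r) for r = 2 - \<sigma>\<close>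

definition mt_corr_sum :: "real \<Rightarrow> real \<Rightarrow> complex \<Rightarrow> complex" where
  "mt_corr_sum x \<sigma> t = (\<Sum>\<^sub>\<infinity>n\<in>{1::nat..}. of_nat n powr (of_real \<sigma> - 2) * mt_corr x \<sigma> n t)"

lemma norm_mt_corr_sum_term_le:
  assumes "n \<ge> 1" "x > 0" "0 < \<sigma>" "\<sigma> < 1" "0 \<le> \<eta>" "\<eta> < \<sigma>" "Re t \<ge> - \<eta>" "norm t \<le> R"
  shows "norm (of_nat n powr (of_real \<sigma> - 2) * mt_corr x \<sigma> n t)
          \<le> (\<sigma> + R + 1) * (1 + x) powr \<eta> * (LINT u:{0<..}|lborel. corr_bound \<sigma> \<eta> u) * real n powr (\<sigma> + \<eta> - 2)"
proof -
  have n: "norm (of_nat n powr (of_real \<sigma> - 2 :: complex)) = real n powr (\<sigma> - 2)"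
    using norm_of_real_powr[of "real n" "of_real \<sigma> - 2"] assms by simp
  have "norm (of_nat n powr (of_real \<sigma> - 2) * mt_corr x \<sigma> n t) \<le> real n powr (\<sigma> - 2) *
      ((\<sigma> + R + 1) * (1 + x) powr \<eta> * real n powr \<eta> * (LINT u:{0<..}|lborel. corr_bound \<sigma> \<eta> u))"
    unfolding norm_mult n by (intro mult_left_mono norm_mt_corr_le assms) auto
  also have "\<dots> = (\<sigma> + R + 1) * (1 + x) powr \<eta> * (LINT u:{0<..}|lborel. corr_bound \<sigma> \<eta> u)
      * (real n powr (\<sigma> - 2) * real n powr \<eta>)"
    by (simp add: mult_ac)
  also have "real n powr (\<sigma> - 2) * real n powr \<eta> = real n powr (\<sigma> + \<eta> - 2)"
    using powr_add[of "real n" "\<sigma> - 2" \<eta>] by (simp add: algebra_simps)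
  finally show ?thesis .
qed

lemma mt_corr_sum_summable:
  assumes "x > 0" "0 < \<sigma>" "\<sigma> < 1" "Re t \<ge> 0"
  shows "(\<lambda>n. of_nat n powr (of_real \<sigma> - 2) * mt_corr x \<sigma> n t) summable_on {1::nat..}"
proof (rule abs_summable_summable, rule Infinite_Sum.abs_summable_on_comparison_test')
  let ?C = "(\<sigma> + norm t + 1) * (1 + x) powr 0 * (LINT u:{0<..}|lborel. corr_bound \<sigma> 0 u)"
  show "(\<lambda>n. ?C * real n powr (\<sigma> + 0 - 2)) summable_on {1..}"
    using assms by (intro summable_on_cmult_right real_powr_summable_on) auto
qed (use norm_mt_corr_sum_term_le[of _ x \<sigma> 0 t "norm t"] assms in auto)

text \<open>The two upper bounds on \<eta> have different origins: \<eta> < \<sigma> makes the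
  integral over \<open>u\<close> converge, \<eta> < 1 - \<sigma> the sum of n^(\<sigma> + \<eta> -
  2). Some positive \<eta> meets both, so t = 0 is an interior point.\<close>

lemma holomorphic_mt_corr_sum:
  assumes "x > 0" "0 < \<sigma>" "\<sigma> < 1" "0 \<le> \<eta>" "\<eta> < \<sigma>" "\<eta> < 1 - \<sigma>"
  shows "mt_corr_sum x \<sigma> holomorphic_on {t. Re t > - \<eta>}"
  unfolding mt_corr_sum_def[abs_def]
proof (rule holomorphic_on_infsum_dominated[OF open_Re_gt])
  show "(\<lambda>t. of_nat n powr (of_real \<sigma> - 2) * mt_corr x \<sigma> n t) holomorphic_on {t. Re t > - \<eta>}"
    if "n \<in> {1..}" for n :: nat
    using that assms holomorphic_mt_corr[of n x \<sigma> \<eta>] by (intro holomorphic_intros) auto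
  fix t0 assume t0: "t0 \<in> {t. Re t > - \<eta>}"
  define d where "d = min 1 (Re t0 + \<eta>)"
  let ?C = "(\<sigma> + (norm t0 + 1) + 1) * (1 + x) powr \<eta> * (LINT u:{0<..}|lborel. corr_bound \<sigma> \<eta> u)"
  have "norm (of_nat n powr (of_real \<sigma> - 2) * mt_corr x \<sigma> n t) \<le> ?C * real n powr (\<sigma> + \<eta> - 2)"
    if t: "t \<in> ball t0 d" and n: "n \<in> {1..}" for t and n :: nat
  proof -
    have "norm (t0 - t) < d" using t by (simp add: dist_norm)
    moreover have "\<bar>Re t0 - Re t\<bar> \<le> norm (t0 - t)" using abs_Re_le_cmod[of "t0 - t"] by simp
    moreover have "norm t \<le> norm t0 + norm (t0 - t)" by (metis norm_minus_commute norm_triangle_sub)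
    ultimately have "- \<eta> \<le> Re t" "norm t \<le> norm t0 + 1" by (auto simp: d_def)
    thus ?thesis using n assms by (intro norm_mt_corr_sum_term_le) auto
  qed
  moreover have "(\<lambda>n. ?C * real n powr (\<sigma> + \<eta> - 2)) summable_on {1..}"
    using assms by (intro summable_on_cmult_right real_powr_summable_on) auto
  moreover have "d > 0" using t0 by (simp add: d_def)
  ultimately show "\<exists>d>0. \<exists>B. B summable_on {1..} \<and> (\<forall>t\<in>ball t0 d. \<forall>n\<in>{1..}.
      norm (of_nat n powr (of_real \<sigma> - 2) * mt_corr x \<sigma> n t) \<le> B n)"
    by blast
qed

text \<open>The corrections at t = 0 are all equal to zeta(\<sigma>), so the sum over n factors; its
  exponent 2 - \<sigma> exceeds 1, where the series for \<open>zeta\<close> is available.\<close>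

lemma mt_corr_sum_0:
  assumes "x > 0" "0 < \<sigma>" "\<sigma> < 1"
  shows "mt_corr_sum x \<sigma> 0 = zeta (2 - of_real \<sigma>) * zeta (of_real \<sigma>)"
proof -
  have "mt_corr_sum x \<sigma> 0 = (\<Sum>\<^sub>\<infinity>n\<in>{1::nat..}. 1 / of_nat n powr (2 - of_real \<sigma>) * zeta (of_real \<sigma>))"
    unfolding mt_corr_sum_def using assms powr_minus_divide[of _ "2 - of_real \<sigma> :: complex"]
    by (intro infsum_cong) (simp add: mt_corr_0)
  also have "\<dots> = zeta (2 - of_real \<sigma>) * zeta (of_real \<sigma>)"
    unfolding infsum_cmult_left' using assms by (simp add: zeta_eq_series)
  finally show ?thesis .
qed

text \<open>In the main term the exponents of n add up to (\<sigma> - 2) + (1 - \<sigma> - \<tau>) =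
  -(1 + \<tau>), which produces zeta(1 + \<tau>). The reciprocal Gamma factor of the Beta function
  is kept as the entire function \<open>rGamma\<close>, whose zero at 0 will meet the pole.\<close>

lemma MT_series_eq:
  assumes x: "x > 0" and \<sigma>: "0 < \<sigma>" "\<sigma> < 1" and \<tau>: "\<tau> > 1"
  shows "MT_series (2 - of_real \<sigma>) (of_real \<sigma>) (of_real \<tau>) x =
     of_real x powr (of_real \<sigma> - 1) * Gamma (1 - of_real \<sigma>) * Gamma (of_real \<sigma> + of_real \<tau> - 1)
        * rGamma (of_real \<tau>) * zeta (1 + of_real \<tau>) + mt_corr_sum x \<sigma> (of_real \<tau>)"
proof -
  define B where "B = complex_of_real (x powr (\<sigma> - 1) * Beta (1 - \<sigma>) (\<sigma> + \<tau> - 1))"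
  have B: "B = of_real x powr (of_real \<sigma> - 1) * Gamma (1 - of_real \<sigma>) * Gamma (of_real \<sigma> + of_real \<tau> - 1)
        * rGamma (of_real \<tau>)"
  proof -
    have "complex_of_real x powr (of_real \<sigma> - 1) = of_real (x powr (\<sigma> - 1))"
      using powr_of_real[of x "\<sigma> - 1"] x by simp
    moreover have "Gamma (1 - complex_of_real \<sigma>) = of_real (Gamma (1 - \<sigma>))"
      "Gamma (of_real \<sigma> + of_real \<tau> - 1) = complex_of_real (Gamma (\<sigma> + \<tau> - 1))"
      "rGamma (complex_of_real \<tau>) = of_real (rGamma \<tau>)"
      by (simp_all add: Gamma_complex_of_real[symmetric] rGamma_complex_of_real[symmetric])
    ultimately show ?thesis by (simp add: B_def Beta_altdef)
  qed
  have "MT_series (2 - of_real \<sigma>) (of_real \<sigma>) (of_real \<tau>) x =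
      (\<Sum>\<^sub>\<infinity>n\<in>{1::nat..}. of_nat n powr (of_real \<sigma> - 2) * mt_corr x \<sigma> n (of_real \<tau>)
         + B * (1 / of_nat n powr (1 + of_real \<tau>)))"
    unfolding MT_series_def
  proof (intro infsum_cong)
    fix n :: nat assume n: "n \<in> {1..}"
    have "(\<Sum>\<^sub>\<infinity>m\<in>{1::nat..}. 1 / (of_nat n powr (2 - of_real \<sigma>) * of_nat m powr of_real \<sigma> *
              of_real (real n + real m * x) powr of_real \<tau>))
        = (\<Sum>\<^sub>\<infinity>m\<in>{1::nat..}. of_nat n powr (of_real \<sigma> - 2) * mt_term x \<sigma> n (of_real \<tau>) (real m))"
    proof (intro infsum_cong)
      fix m :: nat
      have "of_nat n powr (of_real \<sigma> - 2) = 1 / (of_nat n powr (2 - of_real \<sigma>) :: complex)"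
        using powr_minus_divide[of "of_nat n :: complex" "2 - of_real \<sigma>"] by simp
      thus "1 / (of_nat n powr (2 - of_real \<sigma>) * of_nat m powr of_real \<sigma> *
              of_real (real n + real m * x) powr of_real \<tau>)
        = of_nat n powr (of_real \<sigma> - 2) * mt_term x \<sigma> n (of_real \<tau>) (real m)"
        by (simp add: mt_term_def powr_minus_divide)
    qed
    also have "\<dots> = of_nat n powr (of_real \<sigma> - 2) * (\<Sum>\<^sub>\<infinity>m\<in>{1::nat..}. mt_term x \<sigma> n (of_real \<tau>) (real m))"
      by (rule infsum_cmult_right')
    also have "(\<Sum>\<^sub>\<infinity>m\<in>{1::nat..}. mt_term x \<sigma> n (of_real \<tau>) (real m)) =
        mt_corr x \<sigma> n (of_real \<tau>) + B * of_real (real n powr (1 - \<sigma> - \<tau>))"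
      using n x \<sigma> \<tau> by (subst inner_sum_eq) (auto simp: B_def)
    also have "of_nat n powr (of_real \<sigma> - 2) * (mt_corr x \<sigma> n (of_real \<tau>) + B * of_real (real n powr (1 - \<sigma> - \<tau>)))
        = of_nat n powr (of_real \<sigma> - 2) * mt_corr x \<sigma> n (of_real \<tau>)
          + B * (of_nat n powr (of_real \<sigma> - 2) * of_real (real n powr (1 - \<sigma> - \<tau>)))"
      by (simp add: algebra_simps)
    also have "of_nat n powr (of_real \<sigma> - 2) * complex_of_real (real n powr (1 - \<sigma> - \<tau>)) =
        1 / of_nat n powr (1 + of_real \<tau>)"
    proof -
      have "complex_of_real (real n powr (1 - \<sigma> - \<tau>)) = of_nat n powr (1 - of_real \<sigma> - of_real \<tau>)"
        using powr_of_real[of "real n" "1 - \<sigma> - \<tau>"] by simp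
      hence "of_nat n powr (of_real \<sigma> - 2) * complex_of_real (real n powr (1 - \<sigma> - \<tau>)) =
          of_nat n powr ((of_real \<sigma> - 2) + (1 - of_real \<sigma> - of_real \<tau>))"
        by (simp only: powr_add)
      also have "(of_real \<sigma> - 2) + (1 - of_real \<sigma> - of_real \<tau>) = - (1 + complex_of_real \<tau>)" by simp
      finally show ?thesis by (simp only: powr_minus_divide)
    qed
    finally show "(\<Sum>\<^sub>\<infinity>m\<in>{1::nat..}. 1 / (of_nat n powr (2 - of_real \<sigma>) * of_nat m powr of_real \<sigma> *
              of_real (real n + real m * x) powr of_real \<tau>)) =
        of_nat n powr (of_real \<sigma> - 2) * mt_corr x \<sigma> n (of_real \<tau>) + B * (1 / of_nat n powr (1 + of_real \<tau>))" .
  qed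
  also have "\<dots> = mt_corr_sum x \<sigma> (of_real \<tau>) + (\<Sum>\<^sub>\<infinity>n\<in>{1::nat..}. B * (1 / of_nat n powr (1 + of_real \<tau>)))"
    unfolding mt_corr_sum_def
  proof (intro infsum_add mt_corr_sum_summable summable_on_cmult_right x \<sigma>)
    have "(\<lambda>n. norm (1 / of_nat n powr (1 + of_real \<tau>) :: complex)) summable_on {1::nat..}"
    proof -
      have "norm (1 / of_nat n powr (1 + of_real \<tau>) :: complex) = real n powr (- 1 - \<tau>)" if "n \<in> {1..}" for n :: nat
        using norm_of_real_powr[of "real n" "1 + of_real \<tau>"] powr_minus_divide[of "real n" "1 + \<tau>"] that
        by (simp add: norm_divide)
      moreover have "(\<lambda>n. real n powr (- 1 - \<tau>)) summable_on {1..}"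
        using \<tau> by (intro real_powr_summable_on) auto
      ultimately show ?thesis by (subst summable_on_cong)
    qed
    thus "(\<lambda>n. 1 / of_nat n powr (1 + of_real \<tau>) :: complex) summable_on {1::nat..}"
      by (rule abs_summable_summable)
  qed (use \<tau> in auto)
  also have "(\<Sum>\<^sub>\<infinity>n\<in>{1::nat..}. B * (1 / of_nat n powr (1 + of_real \<tau>))) = B * zeta (1 + of_real \<tau>)"
    unfolding infsum_cmult_right' using \<tau> by (simp add: zeta_eq_series)
  finally show ?thesis by (simp add: B)
qed

section \<open>Restriction of functions of three variables to holomorphic curves\<close>

lemma holomorphic3_on_compose:
  assumes F: "holomorphic3_on F U" and V: "open V"
    and abc: "a holomorphic_on V" "b holomorphic_on V" "c holomorphic_on V"
    and sub: "\<And>z. z \<in> V \<Longrightarrow> (a z, b z, c z) \<in> U"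
  shows "(\<lambda>z. F (a z, b z, c z)) holomorphic_on V"
  unfolding holomorphic_on_open[OF V]
proof
  fix z assume z: "z \<in> V"
  obtain A B C where D: "(F has_derivative (\<lambda>(h, k, l). A * h + B * k + C * l)) (at (a z, b z, c z))"
    using F sub[OF z] unfolding holomorphic3_on_def by metis
  have d: "(f has_derivative (*) (deriv f z)) (at z)" if "f holomorphic_on V" for f
    using holomorphic_derivI[OF that V z] by (simp add: has_field_derivative_def)
  have "((\<lambda>z. F (a z, b z, c z)) has_derivative
      (\<lambda>h. (\<lambda>(h, k, l). A * h + B * k + C * l) (deriv a z * h, deriv b z * h, deriv c z * h))) (at z)"
    by (rule has_derivative_compose[where f = "\<lambda>z. (a z, b z, c z)" and g = F, OF _ D]) (intro has_derivative_Pair d abc)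
  also have "(\<lambda>h. (\<lambda>(h, k, l). A * h + B * k + C * l) (deriv a z * h, deriv b z * h, deriv c z * h)) =
      (*) (A * deriv a z + B * deriv b z + C * deriv c z)"
    by (auto simp: algebra_simps)
  finally show "\<exists>f'. ((\<lambda>z. F (a z, b z, c z)) has_field_derivative f') (at z)"
    unfolding has_field_derivative_def by blast
qed

lemma holomorphic_Mordell_Tornheim:
  assumes "is_Mordell_Tornheim \<Theta>" "x > 0" "open V"
    and "a holomorphic_on V" "b holomorphic_on V" "c holomorphic_on V"
    and "\<And>z. z \<in> V \<Longrightarrow> (a z, b z, c z) \<notin> MT_hyperplanes"
  shows "(\<lambda>z. \<Theta> (a z) (b z) (c z) x) holomorphic_on V"
proof -
  have "holomorphic3_on (\<lambda>(r, s, t). \<Theta> r s t x) (- MT_hyperplanes)"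
    using assms(1,2) unfolding is_Mordell_Tornheim_def meromorphic3_sing_def by blast
  from holomorphic3_on_compose[OF this assms(3-6)] assms(7) show ?thesis by simp
qed

lemma tendsto_base_case_real:
  assumes MT: "is_Mordell_Tornheim \<Theta>" and x: "x > 0" and \<sigma>: "0 < \<sigma>" "\<sigma> < 1"
  shows "((\<lambda>t. \<Theta> (2 - of_real \<sigma>) (of_real \<sigma>) t x) \<longlongrightarrow>
           of_real x powr (of_real \<sigma> - 1) * Gamma (1 - of_real \<sigma>) * Gamma (of_real \<sigma> - 1)
             + zeta (2 - of_real \<sigma>) * zeta (of_real \<sigma>)) (at 0)"
proof -
  \<comment> \<open>Below both \<sigma> and 1 - \<sigma>, as the correction sum requires; the same
    bounds keep all but two singular points out of the half-plane.\<close>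
  define \<eta> where "\<eta> = min \<sigma> (1 - \<sigma>) / 2"
  have \<eta>: "0 < \<eta>" "\<eta> < \<sigma>" "\<eta> < 1 - \<sigma>" using \<sigma> by (auto simp: \<eta>_def)
  \<comment> \<open>With r = 2 - \<sigma> and s = \<sigma>, the point 0 is where r + s + t = 2 and 1
    - \<sigma> is where s + t = 1. All other singular points have Re t \<le> \<sigma> - 1 or Re t
    \<le> -\<sigma>.\<close>
  define U where "U = {t. Re t > - \<eta>} - {0, 1 - of_real \<sigma>}"
  have "open U" unfolding U_def by (intro open_Diff open_Re_gt) auto
  have "connected U" unfolding U_def
    by (intro connected_open_delete_finite open_Re_gt convex_connected convex_halfspace_Re_gt) auto
  define A where "A t = of_real x powr (of_real \<sigma> - 1) * Gamma (1 - of_real \<sigma>) * Gamma (of_real \<sigma> + t - 1)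
        * rGamma t * zeta (1 + t)" for t
  have hyp: "(2 - of_real \<sigma>, of_real \<sigma>, t) \<notin> MT_hyperplanes" if t: "t \<in> U" for t
  proof
    assume "(2 - of_real \<sigma>, of_real \<sigma>, t) \<in> MT_hyperplanes"
    then consider l :: nat where "2 - of_real \<sigma> + t = 1 - of_nat l"
      | l :: nat where "of_real \<sigma> + t = 1 - of_nat l" | "2 - of_real \<sigma> + of_real \<sigma> + t = 2"
      unfolding MT_hyperplanes_def by auto
    thus False
    proof cases
      case 1
      hence "2 - \<sigma> + Re t = 1 - real l" by (auto simp: complex_eq_iff)
      thus False using t \<eta> \<sigma> by (auto simp: U_def)
    next
      case 2
      hence "\<sigma> + Re t = 1 - real l" by (auto simp: complex_eq_iff)
      moreover have "l \<noteq> 0" using 2 t by (cases l) (auto simp: U_def algebra_simps)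
      hence "real l \<ge> 1" by simp
      ultimately show False using t \<eta> \<sigma> by (auto simp: U_def)
    qed (use t in \<open>auto simp: U_def\<close>)
  qed
  have nonpos: "of_real \<sigma> + t - 1 \<notin> \<int>\<^sub>\<le>\<^sub>0" if t: "t \<in> U \<union> {0}" for t
  proof
    assume "of_real \<sigma> + t - 1 \<in> \<int>\<^sub>\<le>\<^sub>0"
    then obtain l :: nat where l: "of_real \<sigma> + t - 1 = - of_nat l" by (auto elim!: nonpos_Ints_cases')
    hence "\<sigma> + Re t - 1 = - real l" by (auto simp: complex_eq_iff)
    moreover have "l \<noteq> 0"
    proof
      assume "l = 0"
      hence "t = 1 - of_real \<sigma>" using l by (simp add: algebra_simps)
      thus False using t \<sigma> by (auto simp: U_def)
    qed
    hence "real l \<ge> 1" by simp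
    ultimately show False using t \<eta> \<sigma> by (auto simp: U_def)
  qed
  \<comment> \<open>The identity theorem in t, started from the real ray t > 1 where the double
    series was evaluated.\<close>
  have eq: "\<Theta> (2 - of_real \<sigma>) (of_real \<sigma>) t x - (A t + mt_corr_sum x \<sigma> t) = 0" if "t \<in> U" for t
  proof (rule analytic_continuation[where f = "\<lambda>t. \<Theta> (2 - of_real \<sigma>) (of_real \<sigma>) t x - (A t + mt_corr_sum x \<sigma> t)"
        and S = U and U = "of_real ` {1<..}" and \<xi> = "of_real 2"])
    have "mt_corr_sum x \<sigma> holomorphic_on U"
      using \<eta> \<sigma> x
      by (intro holomorphic_on_subset[OF holomorphic_mt_corr_sum[of x \<sigma> \<eta>]]) (auto simp: U_def)
    moreover have "A holomorphic_on U" unfolding A_def[abs_def]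
      by (intro holomorphic_intros holomorphic_on_compose_gen[OF _ zeta_holomorphic, unfolded o_def] nonpos)
         (auto simp: U_def)
    ultimately show "(\<lambda>t. \<Theta> (2 - of_real \<sigma>) (of_real \<sigma>) t x - (A t + mt_corr_sum x \<sigma> t)) holomorphic_on U"
      by (intro holomorphic_intros holomorphic_Mordell_Tornheim[OF MT x \<open>open U\<close>] hyp) auto
    have "\<tau> \<noteq> 1 - \<sigma>" if "\<tau> > 1" for \<tau> using that \<sigma> by auto
    hence "of_real \<tau> \<noteq> 1 - complex_of_real \<sigma>" if "\<tau> > 1" for \<tau>
      using that by (metis of_real_1 of_real_diff of_real_eq_iff)
    thus "of_real ` {1<..} \<subseteq> U" using \<eta> by (auto simp: U_def)
    thus "of_real 2 \<in> U" by (rule subsetD) (rule imageI, simp)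
    show "complex_of_real 2 islimpt of_real ` {1<..}"
    proof (rule islimpt_isCont_image)
      show "(2::real) islimpt {1<..}" by (rule open_imp_islimpt) auto
      show "\<forall>\<^sub>F y in at 2. complex_of_real y \<noteq> of_real 2"
        unfolding of_real_eq_iff by (auto simp: eventually_at_filter)
    qed auto
    fix z assume "z \<in> complex_of_real ` {1<..}"
    then obtain \<tau> where \<tau>: "z = of_real \<tau>" "\<tau> > 1" by auto
    have "(2 - of_real \<sigma>, of_real \<sigma>, z) \<in> MT_region"
      using \<tau> \<sigma> by (simp add: MT_region_def)
    hence "\<Theta> (2 - of_real \<sigma>) (of_real \<sigma>) z x = MT_series (2 - of_real \<sigma>) (of_real \<sigma>) z x"
      using MT x unfolding is_Mordell_Tornheim_def by blast
    also have "\<dots> = A z + mt_corr_sum x \<sigma> z"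
      unfolding A_def \<tau>(1) by (rule MT_series_eq[OF x \<sigma> \<tau>(2)])
    finally show "\<Theta> (2 - of_real \<sigma>) (of_real \<sigma>) z x - (A z + mt_corr_sum x \<sigma> z) = 0" by simp
  qed (use \<open>open U\<close> \<open>connected U\<close> that in auto)
  have "isCont (\<lambda>t::complex. rGamma (t + 1)) 0"
    by (intro continuous_intros)
  hence lim_rGamma: "((\<lambda>t::complex. rGamma (t + 1)) \<longlongrightarrow> rGamma (0 + 1)) (at 0)"
    by (rule isContD)
  have limA: "(A \<longlongrightarrow> of_real x powr (of_real \<sigma> - 1) * Gamma (1 - of_real \<sigma>) * Gamma (of_real \<sigma> + 0 - 1)
      * rGamma (0 + 1) * 1) (at 0)"
  proof (rule Lim_transform_eventually)
    show "((\<lambda>t. of_real x powr (of_real \<sigma> - 1) * Gamma (1 - of_real \<sigma>) * Gamma (of_real \<sigma> + t - 1)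
      * rGamma (t + 1) * (t * zeta (1 + t))) \<longlongrightarrow> of_real x powr (of_real \<sigma> - 1) * Gamma (1 - of_real \<sigma>)
      * Gamma (of_real \<sigma> + 0 - 1) * rGamma (0 + 1) * 1) (at 0)"
      by (intro tendsto_intros tendsto_zeta_pole lim_rGamma nonpos) auto
    show "\<forall>\<^sub>F t in at 0. of_real x powr (of_real \<sigma> - 1) * Gamma (1 - of_real \<sigma>) * Gamma (of_real \<sigma> + t - 1)
      * rGamma (t + 1) * (t * zeta (1 + t)) = A t"
    proof (intro always_eventually allI)
      fix t :: complex
      \<comment> \<open>The simple zero of 1/\<Gamma> at 0 is split off as a factor t, which
        together with zeta(1 + t) tends to 1.\<close>
      have "rGamma t = t * rGamma (t + 1)" by (simp add: rGamma_plus1)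
      thus "of_real x powr (of_real \<sigma> - 1) * Gamma (1 - of_real \<sigma>) * Gamma (of_real \<sigma> + t - 1)
        * rGamma (t + 1) * (t * zeta (1 + t)) = A t"
        by (simp add: A_def)
    qed
  qed
  have "continuous_on {t. Re t > - \<eta>} (mt_corr_sum x \<sigma>)"
    using holomorphic_mt_corr_sum[of x \<sigma> \<eta>] \<eta> \<sigma> x by (intro holomorphic_on_imp_continuous_on) auto
  hence "isCont (mt_corr_sum x \<sigma>) 0"
    using \<eta> by (simp add: continuous_on_eq_continuous_at open_Re_gt)
  hence limQ: "(mt_corr_sum x \<sigma> \<longlongrightarrow> zeta (2 - of_real \<sigma>) * zeta (of_real \<sigma>)) (at 0)"
    using mt_corr_sum_0[OF x \<sigma>] by (simp add: isCont_def)
  show ?thesis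
  proof (rule Lim_transform_eventually)
    show "((\<lambda>t. A t + mt_corr_sum x \<sigma> t) \<longlongrightarrow>
           of_real x powr (of_real \<sigma> - 1) * Gamma (1 - of_real \<sigma>) * Gamma (of_real \<sigma> - 1)
             + zeta (2 - of_real \<sigma>) * zeta (of_real \<sigma>)) (at 0)"
      using tendsto_add[OF limA limQ] by simp
    have "1 - complex_of_real \<sigma> \<noteq> 0" using \<sigma> by (metis eq_iff_diff_eq_0 less_irrefl of_real_eq_1_iff)
    hence "\<forall>\<^sub>F t in at 0. t \<in> ({t. Re t > - \<eta>} - {1 - of_real \<sigma>}) - {0}"
      using \<eta> by (intro eventually_at_in_open open_delete open_Re_gt) auto
    thus "\<forall>\<^sub>F t in at 0. A t + mt_corr_sum x \<sigma> t = \<Theta> (2 - of_real \<sigma>) (of_real \<sigma>) t x"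
      by eventually_elim (use eq in \<open>auto simp: U_def\<close>)
  qed
qed

subsection \<open>Analytic continuation in r\<close>

text \<open>
  A limit at a removable singularity propagates along a holomorphic parameter, because the Cauchy
  integral over a fixed circle around the singularity is holomorphic in the parameter.
\<close>

lemma tendsto_0_holomorphic_parameter:
  fixes \<Phi> :: "complex \<Rightarrow> complex \<Rightarrow> complex"
  assumes V: "open V" "connected V" and \<rho>: "\<rho> > 0"
    and cont: "continuous_on (V \<times> (ball 0 (2 * \<rho>) - {0})) (\<lambda>(r, t). \<Phi> r t)"
    and hol1: "\<And>t. t \<in> ball 0 (2 * \<rho>) - {0} \<Longrightarrow> (\<lambda>r. \<Phi> r t) holomorphic_on V"
    and hol2: "\<And>r. r \<in> V \<Longrightarrow> \<Phi> r holomorphic_on ball 0 (2 * \<rho>) - {0}"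
    and L: "L holomorphic_on V"
    and W: "W \<subseteq> V" "\<xi> \<in> V" "\<xi> islimpt W" "\<And>r. r \<in> W \<Longrightarrow> (\<Phi> r \<longlongrightarrow> L r) (at 0)"
    and r: "r \<in> V"
  shows "(\<Phi> r \<longlongrightarrow> L r) (at 0)"
proof -
  \<comment> \<open>Only values of \<open>\<Phi>\<close> on the circle enter, so \<open>G\<close> is
    defined at t = 0 for every r, whatever \<open>\<Phi> r\<close> does there.\<close>
  define G where "G r t = contour_integral (circlepath 0 \<rho>) (\<lambda>w. \<Phi> r w / (w - t))" for r t
  have sph: "w \<in> ball 0 (2 * \<rho>) - {0}" if "w \<in> sphere 0 \<rho>" for w :: complex
    using that \<rho> by auto
  have contw: "continuous_on (sphere 0 \<rho>) (\<Phi> r)" if "r \<in> V" for r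
    using sph by (intro holomorphic_on_imp_continuous_on holomorphic_on_subset[OF hol2[OF that]]) blast
  have hasG: "((\<lambda>w. \<Phi> r w / (w - t)) has_contour_integral G r t) (circlepath 0 \<rho>)"
    if "r \<in> V" "t \<in> ball 0 \<rho>" for r t
    unfolding G_def using that \<rho>
    by (intro has_contour_integral_integral contour_integrable_continuous_circlepath continuous_intros)
       (auto intro: contw)
  \<comment> \<open>A Cauchy-type integral is differentiable inside the circle for any continuous
    boundary values; removability for this r is not yet known.\<close>
  have contG: "isCont (G r) 0" if "r \<in> V" for r
  proof -
    have "continuous_on (path_image (circlepath 0 \<rho>)) (\<Phi> r)" using contw[OF that] \<rho> by simp
    from Cauchy_next_derivative_circlepath(2)[OF this, of 1 "G r" 0] hasG[OF that] \<rho>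
    show ?thesis using DERIV_isCont by auto
  qed
  have holG: "(\<lambda>r. G r t) holomorphic_on V" if t: "t \<in> ball 0 \<rho>" for t
  proof -
    have c01: "circlepath 0 \<rho> y \<in> sphere 0 \<rho>" for y
      using \<rho> by (simp add: circlepath norm_mult)
    have cc: "continuous_on A (circlepath 0 \<rho>)" for A
      unfolding circlepath by (intro continuous_intros)
    have "(\<lambda>r. integral {0..1} (\<lambda>y. \<Phi> r (circlepath 0 \<rho> y) / (circlepath 0 \<rho> y - t) *
        vector_derivative (circlepath 0 \<rho>) (at y))) holomorphic_on V"
    proof (rule holomorphic_on_integral_interval[OF V(1)])
      have nt: "circlepath 0 \<rho> y - t \<noteq> 0" for y using c01[of y] t by auto
      have "continuous_on (V \<times> {0..1}) (\<lambda>ry. (\<lambda>(r, t). \<Phi> r t) (fst ry, circlepath 0 \<rho> (snd ry)))"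
        using c01 sph
        by (intro continuous_on_compose2[OF cont] continuous_intros continuous_on_compose2[OF cc[of UNIV]]) force+
      thus "continuous_on (V \<times> {0..1}) (\<lambda>(r, y). \<Phi> r (circlepath 0 \<rho> y) / (circlepath 0 \<rho> y - t) *
          vector_derivative (circlepath 0 \<rho>) (at y))"
        unfolding vector_derivative_circlepath case_prod_unfold
        by (intro continuous_intros continuous_on_compose2[OF cc[of UNIV]]) (use nt in auto)
      show "(\<lambda>r. \<Phi> r (circlepath 0 \<rho> y) / (circlepath 0 \<rho> y - t) *
          vector_derivative (circlepath 0 \<rho>) (at y)) holomorphic_on V" for y
        by (intro holomorphic_intros hol1 sph c01 nt)
    qed
    thus ?thesis by (simp only: G_def[abs_def] contour_integral_integral)
  qed
  define c where "c = 2 * of_real pi * \<i>"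
  have c: "c \<noteq> 0" by (simp add: c_def)
  \<comment> \<open>For parameters in \<open>W\<close> the limit makes the singularity removable, so
    Cauchy's formula holds for the extended function, at the centre too.\<close>
  have GW: "G r t = c * (if t = 0 then L r else \<Phi> r t)" if rW: "r \<in> W" and t: "t \<in> ball 0 \<rho>" for r t
  proof -
    define h where "h t = (if t = 0 then L r else \<Phi> r t)" for t
    have "r \<in> V" using rW W by blast
    have "h holomorphic_on ball 0 (2 * \<rho>)"
      unfolding h_def using W(4)[OF rW] hol2[OF \<open>r \<in> V\<close>] by (intro removable_singularity) auto
    hence "h holomorphic_on cball 0 \<rho>" by (rule holomorphic_on_subset) (use \<rho> in auto)
    hence "((\<lambda>w. h w / (w - t)) has_contour_integral c * h t) (circlepath 0 \<rho>)"
      unfolding c_def using t by (intro Cauchy_integral_circlepath_simple) auto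
    hence "contour_integral (circlepath 0 \<rho>) (\<lambda>w. h w / (w - t)) = c * h t"
      by (rule contour_integral_unique)
    also have "contour_integral (circlepath 0 \<rho>) (\<lambda>w. h w / (w - t)) = G r t"
      unfolding G_def using \<rho> by (intro contour_integral_cong) (auto simp: h_def)
    finally show ?thesis by (simp add: h_def)
  qed
  \<comment> \<open>The identity theorem is applied in r with t held fixed, here for each t \<noteq>
    0 and then once more for t = 0. Continuity of \<open>G r\<close> at 0 combines the two.\<close>
  have G\<Phi>: "G r t = c * \<Phi> r t" if "t \<in> ball 0 \<rho>" "t \<noteq> 0" for t
  proof -
    have "G r t - c * \<Phi> r t = 0"
    proof (rule analytic_continuation[where f = "\<lambda>r. G r t - c * \<Phi> r t" and S = V and U = W and \<xi> = \<xi>])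
      show "(\<lambda>r. G r t - c * \<Phi> r t) holomorphic_on V"
        using that \<rho> by (intro holomorphic_intros holG hol1) auto
    qed (use V W r that GW in auto)
    thus ?thesis by simp
  qed
  have "G r 0 - c * L r = 0"
  proof (rule analytic_continuation[where f = "\<lambda>r. G r 0 - c * L r" and S = V and U = W and \<xi> = \<xi>])
    show "(\<lambda>r. G r 0 - c * L r) holomorphic_on V"
      using \<rho> by (intro holomorphic_intros holG L) auto
  qed (use V W r \<rho> GW in auto)
  hence G0: "G r 0 / c = L r" using c by simp
  have "((\<lambda>t. G r t / c) \<longlongrightarrow> G r 0 / c) (at 0)"
    using isContD[OF contG[OF r]] c by (intro tendsto_intros) auto
  moreover have "\<forall>\<^sub>F t in at 0. G r t / c = \<Phi> r t"
  proof -
    have "\<forall>\<^sub>F t in at 0. t \<in> ball 0 \<rho> - {0::complex}"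
      using \<rho> by (intro eventually_at_in_open) auto
    thus ?thesis by eventually_elim (use G\<Phi> c in auto)
  qed
  ultimately show ?thesis unfolding G0 by (rule Lim_transform_eventually)
qed

definition base_value :: "real \<Rightarrow> complex \<Rightarrow> complex" where
  "base_value x r = of_real x powr (1 - r) * Gamma (1 - r) * Gamma (r - 1) + zeta r * zeta (2 - r)"

text \<open>If r + t = 1 - l or 2 - r + t = 1 - l, then r differs from an integer by t or -t. A
  lower bound \<delta> for the distance of \<open>V\<close> from the integers thus keeps the
  punctured disc |t| < \<delta> free of singularities for all r in \<open>V\<close> at once, and one
  circle of radius \<delta>/2 serves the whole domain.\<close>

lemma tendsto_base_extend:
  assumes MT: "is_Mordell_Tornheim \<Theta>" and x: "x > 0"
    and V: "open V" "connected V" and \<delta>: "\<delta> > 0"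
    and dist: "\<And>r k. r \<in> V \<Longrightarrow> norm (r - of_int k) \<ge> \<delta>"
    and W: "W \<subseteq> V" "\<xi> \<in> V" "\<xi> islimpt W"
      "\<And>r. r \<in> W \<Longrightarrow> ((\<lambda>t. \<Theta> r (2 - r) t x) \<longlongrightarrow> base_value x r) (at 0)"
    and r: "r \<in> V"
  shows "((\<lambda>t. \<Theta> r (2 - r) t x) \<longlongrightarrow> base_value x r) (at 0)"
proof (rule tendsto_0_holomorphic_parameter[where V = V and \<rho> = "\<delta> / 2" and \<Phi> = "\<lambda>r t. \<Theta> r (2 - r) t x", OF V])
  let ?B = "ball 0 (2 * (\<delta> / 2)) - {0::complex}"
  have hyp: "(r, 2 - r, t) \<notin> MT_hyperplanes" if "r \<in> V" "t \<in> ?B" for r t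
  proof
    assume "(r, 2 - r, t) \<in> MT_hyperplanes"
    then consider l :: nat where "r + t = 1 - of_nat l" | l :: nat where "2 - r + t = 1 - of_nat l" | "t = 0"
      unfolding MT_hyperplanes_def by auto
    thus False
    proof cases
      case 1
      hence "r - of_int (1 - int l) = - t" by (simp add: algebra_simps)
      thus False using dist[OF that(1), of "1 - int l"] that(2) by simp
    next
      case 2
      hence "r - of_int (1 + int l) = t" by (simp add: algebra_simps)
      thus False using dist[OF that(1), of "1 + int l"] that(2) by simp
    qed (use that in auto)
  qed
  have H: "holomorphic3_on (\<lambda>(r, s, t). \<Theta> r s t x) (- MT_hyperplanes)"
    using MT x unfolding is_Mordell_Tornheim_def meromorphic3_sing_def by blast
  have "continuous_on (- MT_hyperplanes) (\<lambda>(r, s, t). \<Theta> r s t x)"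
    unfolding continuous_on_eq_continuous_within
  proof
    fix p assume "p \<in> - MT_hyperplanes"
    then obtain a b c where "((\<lambda>(r, s, t). \<Theta> r s t x) has_derivative (\<lambda>(h, k, l). a * h + b * k + c * l)) (at p)"
      using H unfolding holomorphic3_on_def by blast
    thus "continuous (at p within - MT_hyperplanes) (\<lambda>(r, s, t). \<Theta> r s t x)"
      by (rule continuous_at_imp_continuous_at_within[OF has_derivative_continuous])
  qed
  moreover have "(fst rt, 2 - fst rt, snd rt) \<notin> MT_hyperplanes" if "rt \<in> V \<times> ?B" for rt
    by (intro hyp) (use that in auto)
  ultimately have "continuous_on (V \<times> ?B) (\<lambda>rt. (\<lambda>(r, s, t). \<Theta> r s t x) (fst rt, 2 - fst rt, snd rt))"
    by (elim continuous_on_compose2) (intro continuous_intros, blast)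
  thus "continuous_on (V \<times> ?B) (\<lambda>(r, t). \<Theta> r (2 - r) t x)"
    by (simp add: case_prod_unfold)
  show "(\<lambda>r. \<Theta> r (2 - r) t x) holomorphic_on V" if "t \<in> ?B" for t
    using hyp that by (intro holomorphic_Mordell_Tornheim[OF MT x V(1)] holomorphic_intros) auto
  show "(\<lambda>t. \<Theta> r (2 - r) t x) holomorphic_on ?B" if "r \<in> V" for r
    using hyp that by (intro holomorphic_Mordell_Tornheim[OF MT x] holomorphic_intros) auto
  have nz: "r \<notin> \<int>" if "r \<in> V" for r
  proof
    assume "r \<in> \<int>"
    then obtain k where "r = of_int k" by (rule Ints_cases)
    thus False using dist[OF that, of k] \<delta> by simp
  qed
  have "1 - r \<notin> \<int>\<^sub>\<le>\<^sub>0" "r - 1 \<notin> \<int>\<^sub>\<le>\<^sub>0" "r \<noteq> 1" "2 - r \<noteq> 1" if "r \<in> V" for r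
  proof -
    have "1 - r \<notin> \<int>" "r - 1 \<notin> \<int>"
      using nz[OF that] Ints_diff[OF Ints_1, of "1 - r"] Ints_add[OF _ Ints_1, of "r - 1"] by auto
    thus "1 - r \<notin> \<int>\<^sub>\<le>\<^sub>0" "r - 1 \<notin> \<int>\<^sub>\<le>\<^sub>0" by (auto dest: nonpos_Ints_Int)
    show "r \<noteq> 1" using nz[OF that] by auto
    thus "2 - r \<noteq> 1" by (auto simp: algebra_simps)
  qed
  thus "base_value x holomorphic_on V"
    unfolding base_value_def[abs_def] using x
    by (intro holomorphic_intros holomorphic_on_compose_gen[OF _ zeta_holomorphic, unfolded o_def]) auto
qed (use assms in auto)

text \<open>Three kinds of domain are chained. The real interval (1,2) seeds the strip 1 < Re r < 2;
  this strip meets every half-plane above or below the real axis; and the upper half-plane meets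
  every strip between consecutive integers, which brings in the remaining real non-integers.\<close>

lemma tendsto_base_case:
  assumes MT: "is_Mordell_Tornheim \<Theta>" and x: "x > 0" and r: "r \<notin> \<int>"
  shows "((\<lambda>t. \<Theta> r (2 - r) t x) \<longlongrightarrow> base_value x r) (at 0)"
proof -
  let ?P = "\<lambda>r. ((\<lambda>t. \<Theta> r (2 - r) t x) \<longlongrightarrow> base_value x r) (at 0)"
  \<comment> \<open>The strips are narrowed by \<delta> on both sides to keep that distance from all
    integers.\<close>
  define strip where "strip k \<delta> = {r. Re r > of_int k + \<delta>} \<inter> {r. Re r < of_int k + 1 - \<delta>}" for k :: int and \<delta> :: real
  have strip: "open (strip k \<delta>)" "connected (strip k \<delta>)" for k \<delta>
    unfolding strip_def
    by (auto intro!: open_Int open_halfspace_Re_gt open_halfspace_Re_lt convex_connected convex_Int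
          convex_halfspace_Re_gt convex_halfspace_Re_lt)
  have strip_dist: "norm (r - of_int j) \<ge> \<delta>" if "r \<in> strip k \<delta>" for r j k \<delta>
  proof -
    have "j \<le> k \<or> j \<ge> k + 1" by linarith
    hence "real_of_int j \<le> of_int k \<or> real_of_int j \<ge> of_int k + 1" by linarith
    hence "\<bar>Re r - of_int j\<bar> \<ge> \<delta>" using that by (auto simp: strip_def)
    thus ?thesis using abs_Re_le_cmod[of "r - of_int j"] by simp
  qed
  have in_strip: "\<exists>\<delta>>0. \<delta> < 1 / 2 \<and> r \<in> strip k \<delta>" if "of_int k < Re r" "Re r < of_int k + 1" for r k
    using that by (intro exI[of _ "min (Re r - of_int k) (of_int k + 1 - Re r) / 2"])
                  (auto simp: strip_def field_simps min_def)
  have 1: "?P r" if Re_r: "1 < Re r" "Re r < 2" for r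
  proof -
    obtain \<delta> where \<delta>: "\<delta> > 0" "\<delta> < 1 / 2" "r \<in> strip 1 \<delta>" using in_strip[of 1 r] Re_r by auto
    show ?thesis
    proof (rule tendsto_base_extend[OF MT x strip \<delta>(1) strip_dist])
      show "of_real ` {1 + \<delta><..<2 - \<delta>} \<subseteq> strip 1 \<delta>" by (auto simp: strip_def)
      show "of_real (3 / 2) \<in> strip 1 \<delta>" using \<delta> by (simp add: strip_def)
      show "complex_of_real (3 / 2) islimpt of_real ` {1 + \<delta><..<2 - \<delta>}"
      proof (rule islimpt_isCont_image)
        show "(3 / 2 :: real) islimpt {1 + \<delta><..<2 - \<delta>}" using \<delta> by (intro open_imp_islimpt) auto
        show "\<forall>\<^sub>F y in at (3 / 2). complex_of_real y \<noteq> of_real (3 / 2)"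
          unfolding of_real_eq_iff by (auto simp: eventually_at_filter)
      qed auto
      fix r' assume "r' \<in> complex_of_real ` {1 + \<delta><..<2 - \<delta>}"
      then obtain u where u: "r' = of_real u" "1 + \<delta> < u" "u < 2 - \<delta>" by auto
      have "r' = 2 - of_real (2 - u)" by (simp add: u)
      thus "?P r'"
        using tendsto_base_case_real[OF MT x, of "2 - u"] u \<delta> by (simp add: base_value_def mult_ac)
    qed (use \<delta> in auto)
  qed
  have 2: "?P r" if "Im r \<noteq> 0" for r
  proof -
    \<comment> \<open>Half the height of \<open>r\<close>: the half-plane beyond it contains
      \<open>r\<close> and has distance |c| from the real axis.\<close>
    define c where "c = Im r / 2"
    define V where "V = (if c > 0 then {z. Im z > c} else {z. Im z < c})"
    define \<xi> where "\<xi> = Complex (3 / 2) (Im r)"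
    have V: "open V" "connected V"
      by (auto simp: V_def intro!: open_halfspace_Im_gt open_halfspace_Im_lt convex_connected
          convex_halfspace_Im_gt convex_halfspace_Im_lt)
    let ?W = "V \<inter> strip 1 0"
    show ?thesis
    proof (rule tendsto_base_extend[OF MT x V, where W = ?W and \<xi> = \<xi> and \<delta> = "\<bar>c\<bar>"])
      show "\<bar>c\<bar> \<le> norm (z - of_int k)" if "z \<in> V" for z k
        using that abs_Im_le_cmod[of "z - of_int k"] by (auto simp: V_def split: if_splits)
      show "\<xi> \<in> V" using that by (auto simp: V_def \<xi>_def c_def)
      moreover have "\<xi> \<in> strip 1 0" by (simp add: strip_def \<xi>_def)
      ultimately show "\<xi> islimpt ?W"
        using strip V by (intro open_imp_islimpt open_Int) auto
      show "?P z" if "z \<in> ?W" for z using that by (intro 1) (auto simp: strip_def)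
      show "r \<in> V" using that by (auto simp: V_def c_def)
    qed (use that in \<open>auto simp: c_def\<close>)
  qed
  show ?thesis
  proof (cases "Im r = 0")
    case True
    hence "Re r \<notin> \<int>" using r complex_eqI[of r "of_int k" for k] by (auto elim!: Ints_cases)
    hence "of_int \<lfloor>Re r\<rfloor> \<noteq> Re r" by (metis Ints_of_int)
    hence "of_int \<lfloor>Re r\<rfloor> < Re r" "Re r < of_int \<lfloor>Re r\<rfloor> + 1" by linarith+
    then obtain \<delta> where \<delta>: "\<delta> > 0" "r \<in> strip \<lfloor>Re r\<rfloor> \<delta>" using in_strip by blast
    let ?W = "strip \<lfloor>Re r\<rfloor> \<delta> \<inter> {z. Im z > 0}"
    have Wopen: "open ?W" by (intro open_Int strip open_halfspace_Im_gt)
    have "r + \<i> \<in> ?W" using \<delta> True by (auto simp: strip_def)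
    show ?thesis
    proof (rule tendsto_base_extend[OF MT x strip \<delta>(1) strip_dist])
      show "r + \<i> islimpt ?W" by (rule open_imp_islimpt[OF Wopen \<open>r + \<i> \<in> ?W\<close>])
      show "r + \<i> \<in> strip \<lfloor>Re r\<rfloor> \<delta>" using \<open>r + \<i> \<in> ?W\<close> by blast
      show "?P z" if "z \<in> ?W" for z using that by (intro 2) auto
    qed (use \<delta> in auto)
  qed (use 2 in auto)
qed

subsection \<open>Recursion in r + s\<close>

definition MT_summand :: "complex \<Rightarrow> complex \<Rightarrow> complex \<Rightarrow> real \<Rightarrow> nat \<Rightarrow> nat \<Rightarrow> complex" where
  "MT_summand r s t x n m = 1 / (of_nat n powr r * of_nat m powr s * of_real (real n + real m * x) powr t)"

text \<open>The inequality (n + m x)^2 \<ge> 4 x n m of arithmetic and geometric means separates the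
  two summation variables at the cost of half the exponent t for each.\<close>

lemma norm_MT_summand_le:
  assumes "x > 0" "n \<ge> 1" "m \<ge> 1" "Re t \<ge> 0"
  shows "norm (MT_summand r s t x n m) \<le>
           (4 * x) powr (- (Re t / 2)) * real n powr (- (Re r + Re t / 2)) * real m powr (- (Re s + Re t / 2))"
proof -
  have pos: "real n + real m * x > 0" using assms by (simp add: add_pos_pos)
  have "4 * x * real n * real m \<le> (real n + real m * x)\<^sup>2"
    using sum_squares_bound[of "real n" "real m * x"] by (simp add: power2_eq_square algebra_simps)
  hence "((real n + real m * x)\<^sup>2) powr (- (Re t / 2)) \<le> (4 * x * real n * real m) powr (- (Re t / 2))"
    using assms by (intro powr_mono2') auto
  also have "((real n + real m * x)\<^sup>2) powr (- (Re t / 2)) = (real n + real m * x) powr (- Re t)"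
    using pos by (simp add: powr_powr flip: powr_numeral)
  also have "(4 * x * real n * real m) powr (- (Re t / 2)) =
      (4 * x) powr (- (Re t / 2)) * real n powr (- (Re t / 2)) * real m powr (- (Re t / 2))"
    using assms by (simp add: powr_mult)
  finally have le: "(real n + real m * x) powr (- Re t) \<le>
      (4 * x) powr (- (Re t / 2)) * real n powr (- (Re t / 2)) * real m powr (- (Re t / 2))" .
  have nn: "norm (of_nat k powr z :: complex) = real k powr Re z" if "k \<ge> 1" for k z
    using norm_of_real_powr[of "real k" z] that by simp
  have "norm (MT_summand r s t x n m) = real n powr (- Re r) * real m powr (- Re s) * (real n + real m * x) powr (- Re t)"
    unfolding MT_summand_def norm_divide norm_mult nn[OF assms(2)] nn[OF assms(3)] norm_of_real_powr[OF pos]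
    by (simp add: powr_minus_divide)
  also have "\<dots> \<le> real n powr (- Re r) * real m powr (- Re s) *
      ((4 * x) powr (- (Re t / 2)) * real n powr (- (Re t / 2)) * real m powr (- (Re t / 2)))"
    using le by (intro mult_left_mono) auto
  also have "\<dots> = (4 * x) powr (- (Re t / 2)) * (real n powr (- Re r) * real n powr (- (Re t / 2)))
      * (real m powr (- Re s) * real m powr (- (Re t / 2)))"
    by (simp only: mult_ac)
  finally show ?thesis by (simp only: powr_add[symmetric] minus_add_distrib)
qed

text \<open>The convergence conditions are stronger than those of \<open>MT_region\<close>, but for
  fixed r and s they hold far to the right in t, where the recursion is first established.\<close>

lemma MT_summand_summable:
  assumes x: "x > 0" and "Re t \<ge> 0" "Re r + Re t / 2 > 1" "Re s + Re t / 2 > 1"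
  shows "n \<ge> 1 \<Longrightarrow> MT_summand r s t x n summable_on {1..}"
    and "(\<lambda>n. \<Sum>\<^sub>\<infinity>m\<in>{1..}. MT_summand r s t x n m) summable_on {1..}"
proof -
  let ?A = "\<lambda>n. (4 * x) powr (- (Re t / 2)) * real n powr (- (Re r + Re t / 2))"
  let ?B = "\<lambda>m. real m powr (- (Re s + Re t / 2))"
  have B: "?B summable_on {1..}" using assms by (intro real_powr_summable_on) auto
  have le: "norm (MT_summand r s t x n m) \<le> ?A n * ?B m" if "n \<in> {1..}" "m \<in> {1..}" for n m
    using norm_MT_summand_le[of x n m t r s] that assms by auto
  have abs: "(\<lambda>m. norm (MT_summand r s t x n m)) summable_on {1..}" if "n \<in> {1..}" for n
    by (rule Infinite_Sum.abs_summable_on_comparison_test'[OF summable_on_cmult_right[OF B] le[OF that]])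
  show inner: "MT_summand r s t x n summable_on {1..}" if "n \<ge> 1" for n
    using that by (intro abs_summable_summable[OF abs]) auto
  have bound: "norm (\<Sum>\<^sub>\<infinity>m\<in>{1..}. MT_summand r s t x n m) \<le> ?A n * (\<Sum>\<^sub>\<infinity>m\<in>{1..}. ?B m)" if n: "n \<in> {1..}" for n
  proof -
    have "norm (\<Sum>\<^sub>\<infinity>m\<in>{1..}. MT_summand r s t x n m) \<le> (\<Sum>\<^sub>\<infinity>m\<in>{1..}. ?A n * ?B m)"
    proof (rule norm_infsum_le)
      show "(MT_summand r s t x n has_sum (\<Sum>\<^sub>\<infinity>m\<in>{1..}. MT_summand r s t x n m)) {1..}"
        using inner n by (intro has_sum_infsum) auto
      show "((\<lambda>m. ?A n * ?B m) has_sum (\<Sum>\<^sub>\<infinity>m\<in>{1..}. ?A n * ?B m)) {1..}"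
        by (intro has_sum_infsum summable_on_cmult_right B)
    qed (rule le[OF n])
    thus ?thesis by (simp only: infsum_cmult_right')
  qed
  have sum: "(\<lambda>n. ?A n * (\<Sum>\<^sub>\<infinity>m\<in>{1..}. ?B m)) summable_on {1..}"
    using assms by (intro summable_on_cmult_left summable_on_cmult_right real_powr_summable_on) auto
  show "(\<lambda>n. \<Sum>\<^sub>\<infinity>m\<in>{1..}. MT_summand r s t x n m) summable_on {1..}"
    by (rule abs_summable_summable[OF Infinite_Sum.abs_summable_on_comparison_test'[OF sum bound]])
qed

text \<open>Termwise this expands the numerator of (n + m x) / (n + m x)^(t + 1): the part n lowers
  r, the part m x lowers s. The bounds with 2 leave room for that lowering.\<close>

lemma MT_series_recursion:
  assumes x: "x > 0" and t: "Re t \<ge> 0" "Re r + Re t / 2 > 2" "Re s + Re t / 2 > 2"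
  shows "MT_series r s t x = MT_series (r - 1) s (t + 1) x + of_real x * MT_series r (s - 1) (t + 1) x"
proof -
  have split: "MT_summand r s t x n m =
      MT_summand (r - 1) s (t + 1) x n m + of_real x * MT_summand r (s - 1) (t + 1) x n m"
    if "n \<in> {1..}" "m \<in> {1..}" for n m
  proof -
    have nz: "of_nat n \<noteq> (0::complex)" "of_nat m \<noteq> (0::complex)" using that by auto
    have "real n + real m * x > 0" using that x by (simp add: add_pos_pos)
    hence pz: "complex_of_real (real n + real m * x) \<noteq> 0" by (metis less_irrefl of_real_eq_0_iff)
    have D: "MT_summand r s t x n m = of_real (real n + real m * x) * MT_summand r s (t + 1) x n m"
      using pz by (simp add: MT_summand_def powr_add del: of_real_add)
    have A: "MT_summand (r - 1) s (t + 1) x n m = of_nat n * MT_summand r s (t + 1) x n m"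
      using nz by (simp add: MT_summand_def powr_diff)
    have B: "MT_summand r (s - 1) (t + 1) x n m = of_nat m * MT_summand r s (t + 1) x n m"
      using nz by (simp add: MT_summand_def powr_diff)
    show ?thesis unfolding A B D by (simp add: algebra_simps)
  qed
  have 1: "Re (t + 1) \<ge> 0" "Re (r - 1) + Re (t + 1) / 2 > 1" "Re r + Re (t + 1) / 2 > 1"
     "Re (s - 1) + Re (t + 1) / 2 > 1" "Re s + Re (t + 1) / 2 > 1"
    using t by (auto simp: add_divide_distrib)
  have "(\<Sum>\<^sub>\<infinity>n\<in>{1..}. \<Sum>\<^sub>\<infinity>m\<in>{1..}. MT_summand r s t x n m) =
      (\<Sum>\<^sub>\<infinity>n\<in>{1..}. (\<Sum>\<^sub>\<infinity>m\<in>{1..}. MT_summand (r - 1) s (t + 1) x n m) +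
        of_real x * (\<Sum>\<^sub>\<infinity>m\<in>{1..}. MT_summand r (s - 1) (t + 1) x n m))"
  proof (intro infsum_cong)
    fix n :: nat assume n: "n \<in> {1..}"
    have "(\<Sum>\<^sub>\<infinity>m\<in>{1..}. MT_summand r s t x n m) =
        (\<Sum>\<^sub>\<infinity>m\<in>{1..}. MT_summand (r - 1) s (t + 1) x n m + of_real x * MT_summand r (s - 1) (t + 1) x n m)"
      using n by (intro infsum_cong split)
    also have "\<dots> = (\<Sum>\<^sub>\<infinity>m\<in>{1..}. MT_summand (r - 1) s (t + 1) x n m) +
        (\<Sum>\<^sub>\<infinity>m\<in>{1..}. of_real x * MT_summand r (s - 1) (t + 1) x n m)"
      using n 1 by (intro infsum_add summable_on_cmult_right MT_summand_summable(1) x) auto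
    finally show "(\<Sum>\<^sub>\<infinity>m\<in>{1..}. MT_summand r s t x n m) = (\<Sum>\<^sub>\<infinity>m\<in>{1..}. MT_summand (r - 1) s (t + 1) x n m) +
        of_real x * (\<Sum>\<^sub>\<infinity>m\<in>{1..}. MT_summand r (s - 1) (t + 1) x n m)"
      by (simp only: infsum_cmult_right')
  qed
  also have "\<dots> = (\<Sum>\<^sub>\<infinity>n\<in>{1..}. \<Sum>\<^sub>\<infinity>m\<in>{1..}. MT_summand (r - 1) s (t + 1) x n m) +
      (\<Sum>\<^sub>\<infinity>n\<in>{1..}. of_real x * (\<Sum>\<^sub>\<infinity>m\<in>{1..}. MT_summand r (s - 1) (t + 1) x n m))"
    using 1 by (intro infsum_add summable_on_cmult_right MT_summand_summable(2) x)
  finally show ?thesis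
    unfolding MT_series_def MT_summand_def infsum_cmult_right' .
qed

section \<open>Singular points on a line parallel to the t-axis, and the recursion off them\<close>

lemma MT_hyperplanes_iff:
  "(r, s, t) \<in> MT_hyperplanes \<longleftrightarrow> 1 - r - t \<in> \<nat> \<or> 1 - s - t \<in> \<nat> \<or> t = 2 - r - s"
proof -
  have "(\<exists>l::nat. r + t = 1 - of_nat l) \<longleftrightarrow> 1 - r - t \<in> \<nat>" for r t :: complex
    unfolding Nats_def by (auto simp: algebra_simps image_iff)
  thus ?thesis unfolding MT_hyperplanes_def by (auto simp: algebra_simps)
qed

lemma closed_pole_set: "closed {t::complex. 1 - r - t \<in> \<nat>}"
  using continuous_closed_vimage[of \<nat> "\<lambda>t. 1 - r - t"] by (simp add: vimage_def)

lemma countable_pole_set: "countable {t::complex. 1 - r - t \<in> \<nat>}"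
proof -
  have "{t. 1 - r - t \<in> \<nat>} = range (\<lambda>l. 1 - r - of_nat l)"
    unfolding Nats_def by (auto simp: algebra_simps image_iff)
  thus ?thesis by simp
qed

text \<open>For fixed r and s the singular t form a closed countable set, so their complement is
  open and connected and the series identity spreads from a right half-plane to all of it.\<close>

lemma Mordell_Tornheim_recursion:
  assumes MT: "is_Mordell_Tornheim \<Theta>" and x: "x > 0" and t: "(r, s, t) \<notin> MT_hyperplanes"
  shows "\<Theta> r s t x = \<Theta> (r - 1) s (t + 1) x + of_real x * \<Theta> r (s - 1) (t + 1) x"
proof -
  define U where "U = {t. (r, s, t) \<notin> MT_hyperplanes}"
  have U: "U = - ({t. 1 - r - t \<in> \<nat>} \<union> {t. 1 - s - t \<in> \<nat>} \<union> {2 - r - s})"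
    by (auto simp: U_def MT_hyperplanes_iff)
  have "open U" unfolding U by (intro open_Compl closed_Un closed_pole_set closed_singleton)
  have "connected U" unfolding U
    by (intro path_connected_imp_connected path_connected_complement_countable countable_Un countable_pole_set) auto
  \<comment> \<open>A generous abscissa: to its right all three triples lie in
    \<open>MT_region\<close> and the hypotheses of the series recursion hold.\<close>
  define T where "T = 6 + 2 * \<bar>Re r\<bar> + 2 * \<bar>Re s\<bar>"
  show ?thesis
  proof (rule analytic_continuation_open[where f = "\<lambda>t. \<Theta> r s t x"
        and g = "\<lambda>t. \<Theta> (r - 1) s (t + 1) x + of_real x * \<Theta> r (s - 1) (t + 1) x"])
    show "open {t. Re t > T}" by (rule open_Re_gt)
    have "of_real (T + 1) \<in> {t. Re t > T}" by simp
    thus "{t. Re t > T} \<noteq> {}" by blast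
    have nn: "1 - z - t \<notin> \<nat>" if "Re t > T" "\<bar>Re z\<bar> \<le> \<bar>Re r\<bar> + \<bar>Re s\<bar>" for z t
    proof
      assume "1 - z - t \<in> \<nat>"
      then obtain l where "1 - z - t = of_nat l" by (rule Nats_cases)
      hence "1 - Re z - Re t = real l" by (auto simp: complex_eq_iff)
      thus False using that by (simp add: T_def)
    qed
    show "{t. Re t > T} \<subseteq> U"
    proof
      fix t assume t: "t \<in> {t. Re t > T}"
      have "t \<noteq> 2 - r - s"
      proof
        assume "t = 2 - r - s"
        hence "Re t = 2 - Re r - Re s" by simp
        thus False using t by (simp add: T_def)
      qed
      thus "t \<in> U" using t nn[where z = r and t = t] nn[where z = s and t = t] by (auto simp: U)
    qed
    \<comment> \<open>The shifts preserve r + s + t and one of r + t and s + t, and raise the other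
      by 1, so they create no new singular points.\<close>
    have "(r - 1, s, t + 1) \<notin> MT_hyperplanes" "(r, s - 1, t + 1) \<notin> MT_hyperplanes" if "t \<in> U" for t
    proof -
      have "1 - z - (t + 1) \<in> \<nat> \<Longrightarrow> 1 - z - t \<in> \<nat>" for z
        using Nats_add[OF _ Nats_1, of "1 - z - (t + 1)"] by (simp add: algebra_simps)
      thus "(r - 1, s, t + 1) \<notin> MT_hyperplanes" "(r, s - 1, t + 1) \<notin> MT_hyperplanes"
        using that unfolding U MT_hyperplanes_iff by (auto simp: algebra_simps)
    qed
    thus "(\<lambda>t. \<Theta> (r - 1) s (t + 1) x + of_real x * \<Theta> r (s - 1) (t + 1) x) holomorphic_on U"
      by (intro holomorphic_intros holomorphic_Mordell_Tornheim[OF MT x \<open>open U\<close>])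
    show "(\<lambda>t. \<Theta> r s t x) holomorphic_on U"
      by (intro holomorphic_intros holomorphic_Mordell_Tornheim[OF MT x \<open>open U\<close>]) (simp_all add: U_def)
    fix t assume t: "t \<in> {t. Re t > T}"
    have "\<Theta> r' s' t' x = MT_series r' s' t' x" if "(r', s', t') \<in> MT_region" for r' s' t'
      using MT x that unfolding is_Mordell_Tornheim_def by blast
    moreover have "(r, s, t) \<in> MT_region" "(r - 1, s, t + 1) \<in> MT_region" "(r, s - 1, t + 1) \<in> MT_region"
      using t by (auto simp: MT_region_def T_def)
    moreover have "MT_series r s t x = MT_series (r - 1) s (t + 1) x + of_real x * MT_series r (s - 1) (t + 1) x"
      using t by (intro MT_series_recursion x) (auto simp: T_def)
    ultimately show "\<Theta> r s t x = \<Theta> (r - 1) s (t + 1) x + of_real x * \<Theta> r (s - 1) (t + 1) x"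
      by simp
  qed (use t \<open>open U\<close> \<open>connected U\<close> in \<open>auto simp: U_def\<close>)
qed

section \<open>Pascal's rule and the recursion of the closed form\<close>

lemma binomial_sum_Suc:
  fixes x :: "'a :: comm_semiring_1"
  shows "(\<Sum>k=0..Suc M. of_nat (Suc M choose k) * x ^ (Suc M - k) * g k) =
      (\<Sum>k=0..M. of_nat (M choose k) * x ^ (M - k) * g (Suc k)) +
      x * (\<Sum>k=0..M. of_nat (M choose k) * x ^ (M - k) * g k)"
proof -
  have "x * (\<Sum>k=0..M. of_nat (M choose k) * x ^ (M - k) * g k) =
      (\<Sum>k=0..M. of_nat (M choose k) * x ^ (Suc M - k) * g k)"
    unfolding sum_distrib_left by (intro sum.cong refl) (simp add: Suc_diff_le mult_ac)
  \<comment> \<open>The added term at \<open>Suc M\<close> vanishes with its binomial coefficient;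
    it aligns the range with the other sum before the index shift.\<close>
  also have "\<dots> = (\<Sum>k=0..Suc M. of_nat (M choose k) * x ^ (Suc M - k) * g k)"
    by (simp add: binomial_eq_0)
  also have "\<dots> = x ^ Suc M * g 0 + (\<Sum>k=0..M. of_nat (M choose Suc k) * x ^ (M - k) * g (Suc k))"
    by (subst sum.atLeast0_atMost_Suc_shift) simp
  finally have 1: "x * (\<Sum>k=0..M. of_nat (M choose k) * x ^ (M - k) * g k) = \<dots>" .
  have "(\<Sum>k=0..Suc M. of_nat (Suc M choose k) * x ^ (Suc M - k) * g k) =
      x ^ Suc M * g 0 + (\<Sum>k=0..M. of_nat (Suc M choose Suc k) * x ^ (M - k) * g (Suc k))"
    by (subst sum.atLeast0_atMost_Suc_shift) simp
  also have "(\<Sum>k=0..M. of_nat (Suc M choose Suc k) * x ^ (M - k) * g (Suc k)) =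
      (\<Sum>k=0..M. of_nat (M choose k) * x ^ (M - k) * g (Suc k)) +
      (\<Sum>k=0..M. of_nat (M choose Suc k) * x ^ (M - k) * g (Suc k))"
    by (simp add: sum.distrib[symmetric] algebra_simps)
  finally show ?thesis unfolding 1 by (simp add: add_ac)
qed

definition MT_value :: "real \<Rightarrow> nat \<Rightarrow> complex \<Rightarrow> complex \<Rightarrow> complex" where
  "MT_value x N r s = (-1) ^ N * of_real x powr (s - 1) * fact (N - 2) * Gamma (1 - r) * Gamma (1 - s)
      + (\<Sum>k=0..N-2. of_nat ((N - 2) choose k) * of_real x ^ (N - 2 - k)
                        * zeta (r - of_nat k) * zeta (of_nat k - r + 2))"

text \<open>Lowering r replaces k by k + 1 in the zeta products while lowering s leaves them alone,
  which is Pascal's rule. In the Gamma terms the functional equation gives the factors 1 - r and 1 -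
  s, and their sum -(N - 1) turns (N - 2)! into (N - 1)! and flips the sign.\<close>

lemma MT_value_Suc:
  assumes x: "x > 0" and r: "r \<notin> \<int>" and s: "s \<notin> \<int>" and rs: "r + s = of_nat (Suc N)" and N: "N \<ge> 2"
  shows "MT_value x (Suc N) r s = MT_value x N (r - 1) s + of_real x * MT_value x N r (s - 1)"
proof -
  obtain M where M: "N = M + 2" using N by (metis add.commute le_iff_add)
  define g where "g k = zeta (r - of_nat k) * zeta (of_nat k - r + 2)" for k
  have nonpos: "1 - z \<notin> \<int>\<^sub>\<le>\<^sub>0" if "z \<notin> \<int>" for z :: complex
    using that Ints_diff[OF Ints_1, of "1 - z"] by (auto dest: nonpos_Ints_Int)
  have \<Gamma>: "Gamma (1 - (z - 1)) = (1 - z) * Gamma (1 - z)" if "z \<notin> \<int>" for z :: complex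
    using Gamma_plus1[OF nonpos[OF that]] by (simp add: algebra_simps)
  have xs: "of_real x * of_real x powr (s - 1 - 1) = (of_real x powr (s - 1) :: complex)"
    using x by (simp add: powr_diff power2_eq_square divide_simps)
  let ?G = "of_real x powr (s - 1) * fact M * Gamma (1 - r) * Gamma (1 - s)"
  have v: "MT_value x N r' s' = (-1) ^ N * of_real x powr (s' - 1) * fact M * Gamma (1 - r') * Gamma (1 - s')
      + (\<Sum>k=0..M. of_nat (M choose k) * of_real x ^ (M - k) * (zeta (r' - of_nat k) * zeta (of_nat k - r' + 2)))"
    for r' s'
    by (simp add: MT_value_def M mult_ac)
  have 1: "MT_value x N (r - 1) s = (-1) ^ N * (1 - r) * ?G
      + (\<Sum>k=0..M. of_nat (M choose k) * of_real x ^ (M - k) * g (Suc k))"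
    unfolding v \<Gamma>[OF r] by (simp add: g_def algebra_simps)
  have "of_real x * MT_value x N r (s - 1) = (-1) ^ N * (1 - s) * ((of_real x * of_real x powr (s - 1 - 1)) * fact M * Gamma (1 - r) * Gamma (1 - s))
      + of_real x * (\<Sum>k=0..M. of_nat (M choose k) * of_real x ^ (M - k) * g k)"
    unfolding v \<Gamma>[OF s] by (simp add: g_def algebra_simps)
  hence 2: "of_real x * MT_value x N r (s - 1) = (-1) ^ N * (1 - s) * ?G
      + of_real x * (\<Sum>k=0..M. of_nat (M choose k) * of_real x ^ (M - k) * g k)"
    unfolding xs .
  have "MT_value x (Suc N) r s = (-1) ^ Suc N * of_nat (Suc M) * ?G
      + (\<Sum>k=0..Suc M. of_nat (Suc M choose k) * of_real x ^ (Suc M - k) * g k)"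
  proof -
    have "Suc N - 2 = Suc M" by (simp add: M)
    thus ?thesis unfolding MT_value_def g_def by (simp only: fact_Suc mult_ac)
  qed
  also have "(-1) ^ Suc N * of_nat (Suc M) * ?G = (-1) ^ N * (1 - r) * ?G + (-1) ^ N * (1 - s) * ?G"
  proof -
    have "of_nat (Suc M) = - ((1 - r) + (1 - s))"
    proof -
      have "- ((1 - r) + (1 - s)) = (r + s) - 2" by simp
      thus ?thesis unfolding rs by (simp add: M)
    qed
    thus ?thesis by (simp only: power_Suc) (simp add: algebra_simps)
  qed
  also have "(\<Sum>k=0..Suc M. of_nat (Suc M choose k) * of_real x ^ (Suc M - k) * g k) =
      (\<Sum>k=0..M. of_nat (M choose k) * of_real x ^ (M - k) * g (Suc k)) +
      of_real x * (\<Sum>k=0..M. of_nat (M choose k) * of_real x ^ (M - k) * g k)"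
    by (rule binomial_sum_Suc)
  finally show ?thesis unfolding 1 2 by (simp add: add_ac)
qed

section \<open>The limit for every integer value of r + s\<close>

lemma open_pole_free: "open (- ({t::complex. 1 - r - t \<in> \<nat>} \<union> {t. 1 - s - t \<in> \<nat>}))"
  by (intro open_Compl closed_Un closed_pole_set)

text \<open>At t = 2 - r - s the numbers 1 - r - t and 1 - s - t are s - 1 and r - 1.
  Non-integrality keeps both families of poles away, so the critical point is an isolated
  singularity.\<close>

lemma pole_free_point:
  assumes "r \<notin> \<int>" "s \<notin> \<int>"
  shows "2 - r - s \<in> - ({t::complex. 1 - r - t \<in> \<nat>} \<union> {t. 1 - s - t \<in> \<nat>})"
proof -
  have "z - 1 \<notin> \<nat>" if "z \<notin> \<int>" for z :: complex
    using that Ints_add[OF _ Ints_1, of "z - 1"] Nats_subset_Ints by auto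
  from this[OF assms(1)] this[OF assms(2)] show ?thesis by (auto simp: algebra_simps)
qed

lemma tendsto_MT_value:
  assumes MT: "is_Mordell_Tornheim \<Theta>" and x: "x > 0"
    and "r \<notin> \<int>" "s \<notin> \<int>" "r + s = of_nat N" "N \<ge> 2"
  shows "((\<lambda>t. \<Theta> r s t x) \<longlongrightarrow> MT_value x N r s) (at (2 - r - s))"
  using assms(6,3-5)
proof (induction N arbitrary: r s rule: dec_induct)
  case base
  have s: "s = 2 - r" using base by (simp add: algebra_simps)
  have "MT_value x 2 r s = base_value x r"
    by (simp add: MT_value_def base_value_def s algebra_simps)
  thus ?case using tendsto_base_case[OF MT x base(1)] by (simp add: s)
next
  case (step N)
  let ?t0 = "2 - r - s"
  have ints: "z - 1 \<notin> \<int>" if "z \<notin> \<int>" for z :: complex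
    using that Ints_add[OF _ Ints_1, of "z - 1"] by auto
  \<comment> \<open>Lowering r or s by 1 moves the critical point to \<open>?t0 + 1\<close>, which
    the shift of t in the recursion exactly compensates.\<close>
  have "((\<lambda>t. \<Theta> (r - 1) s t x) \<longlongrightarrow> MT_value x N (r - 1) s) (at (2 - (r - 1) - s))"
    using step ints[OF step.prems(1)] by (intro step.IH) (auto simp: algebra_simps)
  from LIM_offset[OF this, of 1]
  have 1: "((\<lambda>t. \<Theta> (r - 1) s (t + 1) x) \<longlongrightarrow> MT_value x N (r - 1) s) (at ?t0)"
    by (simp add: algebra_simps)
  have "((\<lambda>t. \<Theta> r (s - 1) t x) \<longlongrightarrow> MT_value x N r (s - 1)) (at (2 - r - (s - 1)))"
    using step ints[OF step.prems(2)] by (intro step.IH) (auto simp: algebra_simps)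
  from LIM_offset[OF this, of 1]
  have 2: "((\<lambda>t. \<Theta> r (s - 1) (t + 1) x) \<longlongrightarrow> MT_value x N r (s - 1)) (at ?t0)"
    by (simp add: algebra_simps)
  have "((\<lambda>t. \<Theta> (r - 1) s (t + 1) x + of_real x * \<Theta> r (s - 1) (t + 1) x) \<longlongrightarrow> MT_value x (Suc N) r s) (at ?t0)"
    unfolding MT_value_Suc[OF x step.prems step.hyps(1)] by (intro tendsto_intros 1 2)
  moreover have "\<forall>\<^sub>F t in at ?t0. \<Theta> (r - 1) s (t + 1) x + of_real x * \<Theta> r (s - 1) (t + 1) x = \<Theta> r s t x"
    using eventually_at_in_open[OF open_pole_free pole_free_point[OF step.prems(1,2)]]
  proof eventually_elim
    case (elim t)
    hence "(r, s, t) \<notin> MT_hyperplanes" by (auto simp: MT_hyperplanes_iff)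
    thus ?case by (rule Mordell_Tornheim_recursion[OF MT x, symmetric])
  qed
  ultimately show ?case by (rule Lim_transform_eventually)
qed

theorem theorem2p6:
  fixes \<Theta> :: "complex \<Rightarrow> complex \<Rightarrow> complex \<Rightarrow> real \<Rightarrow> complex"
    and x :: real and r s :: complex and N :: nat
  assumes "is_Mordell_Tornheim \<Theta>"
    and "x > 0"
    and "r \<notin> \<int>" and "s \<notin> \<int>"
    and "r + s = of_nat N" and "N \<ge> 2"
  shows "(\<lambda>t. \<Theta> r s t x
             - ((-1) ^ N * of_real x powr (s - 1) * fact (N - 2) * Gamma (1 - r) * Gamma (1 - s)
                + (\<Sum>k=0..N-2. of_nat ((N - 2) choose k) * of_real x ^ (N - 2 - k)
                                  * zeta (r - of_nat k) * zeta (of_nat k - r + 2))))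
         \<in> O[at (2 - r - s)](\<lambda>t. t - (2 - r - s))"
proof (fold MT_value_def, rule tendsto_holomorphic_imp_bigo)
  let ?A = "- ({t. 1 - r - t \<in> \<nat>} \<union> {t. 1 - s - t \<in> \<nat>})"
  show "open ?A" by (rule open_pole_free)
  show "2 - r - s \<in> ?A" using assms by (intro pole_free_point)
  show "(\<lambda>t. \<Theta> r s t x) holomorphic_on ?A - {2 - r - s}"
    by (intro holomorphic_Mordell_Tornheim[OF assms(1,2)] open_delete open_pole_free holomorphic_intros)
       (auto simp: MT_hyperplanes_iff)
  show "((\<lambda>t. \<Theta> r s t x) \<longlongrightarrow> MT_value x N r s) (at (2 - r - s))"
    using assms by (rule tendsto_MT_value)
qed

end
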